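(* The (probabilistic) unification type of ${\rm FP}(Ł,Ł)$ is nullary.
   Context: Łukasiewicz logic Ł: formulas are built from propositional variables using $\oplus,\neg,\bot$, with the usual derived connectives ($\top=\neg\bot$, $\varphi\to\psi=\neg\varphi\oplus\psi$, $\varphi\odot\psi=\neg(\neg\varphi\oplus\neg\psi)$, $\varphi\vee\psi=(\varphi\to\psi)\to\psi$, $\varphi\wedge\psi=\neg(\neg\varphi\vee\neg\psi)$, $\varphi\leftrightarrow\psi=(\varphi\to\psi)\wedge(\psi\to\varphi)$); axioms $\varphi\to(\psi\to\varphi)$, $(\varphi\to\psi)\to((\psi\to\gamma)\to(\varphi\to\gamma))$, $((\varphi\to\psi)\to\psi)\to((\psi\to\varphi)\to\varphi)$, $(\neg\varphi\to\neg\psi)\to(\psi\to\varphi)$, rule modus ponens. ${\rm FP}(Ł,Ł)$: modal formulas (set ${\bf PFm}$) are built from atomic modal formulas $P(\varphi)$ ($\varphi$ a Łukasiewicz formula, an "event") and $\top,\bot$ by Łukasiewicz connectives; axioms: Ł for events, Ł for modal formulas, $\neg P(\varphi)\leftrightarrow P(\neg\varphi)$, $P(\varphi\to\psi)\to(P(\varphi)\to P(\psi))$, $P(\varphi\oplus\psi)\leftrightarrow[(P(\varphi)\to P(\varphi\odot\psi))\to P(\psi)]$, and the rule: from $\varphi$ derive $P(\varphi)$; $\vdash_{FP}$ is derivability. A (symbolic) probabilistic unification problem is a finite set $\mathcal{I}=\{t_i[P(\varphi_1),\dots,P(\varphi_k)]=u_i[P(\varphi_1),\dots,P(\varphi_k)]: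 i=1,\dots,m\}$ with $t_i,u_i$ Łukasiewicz terms. A probabilistic substitution is a map $\sigma:\{P(\varphi_1),\dots,P(\varphi_k)\}\to{\bf PFm}$ (extended to modal formulas over these atoms by substitution) such that for all $\Phi,\Psi$ over these atoms, $\vdash_{FP}\Phi\leftrightarrow\Psi$ implies $\vdash_{FP}\sigma(\Phi)\leftrightarrow\sigma(\Psi)$. A probabilistic unifier of $\mathcal{I}$ is a probabilistic substitution with $\vdash_{FP}\sigma(t_i)\leftrightarrow\sigma(u_i)$ for all $i$. $\sigma\sqsubseteq\tau$ ($\tau$ more general) if there is a probabilistic substitution $\delta$ on the atomic modal formulas occurring in the $\tau(P(\varphi_i))$ with $\vdash_{FP}\sigma(t)\leftrightarrow\delta(\tau(t))$ for all terms $t$ over $P(\varphi_1),\dots,P(\varphi_k)$; the poset of unifiers is the quotient of this preorder. The unification type of a problem is unitary if this poset has a maximum, finitary if it has no maximum but finitely many maximal elements, infinitary if it has infinitely many maximal elements, nullary otherwise. The unification type of ${\rm FP}(Ł,Ł)$ is the worst type (unitary < finitary < infinitary < nullary) occurring among its probabilistic unification problems.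
   Formalization: The relation ⊑ as defined is not transitive, so the poset is formed from its reflexive-transitive closure on unifiers; the axioms ¬⊥ and φ⊕ψ ↔ (¬φ→ψ), missing from the list, are added; only problems with a unifier are classified, and "finitely many" means at least one. *)

theory Defs
  imports Main
begin

section \<open>Lukasiewicz logic\<close>

datatype (atoms: 'a) fm =
    Atom 'a
  | Bot (\<open>\<^bold>\<bottom>\<close>)
  | Neg "'a fm" (\<open>\<^bold>\<not> _\<close> [80] 80)
  | Oplus "'a fm" "'a fm" (infixr \<open>\<^bold>\<oplus>\<close> 65)

definition Top :: "'a fm" (\<open>\<^bold>\<top>\<close>) where
  "\<^bold>\<top> = \<^bold>\<not> \<^bold>\<bottom>"

definition Imp :: "'a fm \<Rightarrow> 'a fm \<Rightarrow> 'a fm" (infixr \<open>\<^bold>\<rightarrow>\<close> 55) where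
  "\<phi> \<^bold>\<rightarrow> \<psi> = \<^bold>\<not> \<phi> \<^bold>\<oplus> \<psi>"

definition Odot :: "'a fm \<Rightarrow> 'a fm \<Rightarrow> 'a fm" (infixr \<open>\<^bold>\<odot>\<close> 70) where
  "\<phi> \<^bold>\<odot> \<psi> = \<^bold>\<not> (\<^bold>\<not> \<phi> \<^bold>\<oplus> \<^bold>\<not> \<psi>)"

definition Disj :: "'a fm \<Rightarrow> 'a fm \<Rightarrow> 'a fm" (infixr \<open>\<^bold>\<or>\<close> 60) where
  "\<phi> \<^bold>\<or> \<psi> = (\<phi> \<^bold>\<rightarrow> \<psi>) \<^bold>\<rightarrow> \<psi>"

definition Conj :: "'a fm \<Rightarrow> 'a fm \<Rightarrow> 'a fm" (infixr \<open>\<^bold>\<and>\<close> 62) where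
  "\<phi> \<^bold>\<and> \<psi> = \<^bold>\<not> (\<^bold>\<not> \<phi> \<^bold>\<or> \<^bold>\<not> \<psi>)"

definition Iff :: "'a fm \<Rightarrow> 'a fm \<Rightarrow> 'a fm" (infix \<open>\<^bold>\<leftrightarrow>\<close> 53) where
  "\<phi> \<^bold>\<leftrightarrow> \<psi> = (\<phi> \<^bold>\<rightarrow> \<psi>) \<^bold>\<and> (\<psi> \<^bold>\<rightarrow> \<phi>)"

text \<open>
  The first four schemes are the usual ones for implication and negation.  Since the
  primitive connectives here are \<open>\<^bold>\<oplus>\<close>, \<open>\<^bold>\<not>\<close>, \<open>\<^bold>\<bottom>\<close>, these four alone do not
  determine the constant \<open>\<^bold>\<bottom>\<close>, nor a sum \<open>\<phi> \<^bold>\<oplus> \<psi>\<close> whose left summand is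
  not a negation.  The last three schemes say that \<open>\<^bold>\<bottom>\<close> is falsum and that
  \<open>\<phi> \<^bold>\<oplus> \<psi>\<close> is \<open>\<^bold>\<not> \<phi> \<^bold>\<rightarrow> \<psi>\<close>.
\<close>

inductive luk_axiom :: "'a fm \<Rightarrow> bool" where
  L1: "luk_axiom (\<phi> \<^bold>\<rightarrow> (\<psi> \<^bold>\<rightarrow> \<phi>))"
| L2: "luk_axiom ((\<phi> \<^bold>\<rightarrow> \<psi>) \<^bold>\<rightarrow> ((\<psi> \<^bold>\<rightarrow> \<gamma>) \<^bold>\<rightarrow> (\<phi> \<^bold>\<rightarrow> \<gamma>)))"
| L3: "luk_axiom (((\<phi> \<^bold>\<rightarrow> \<psi>) \<^bold>\<rightarrow> \<psi>) \<^bold>\<rightarrow> ((\<psi> \<^bold>\<rightarrow> \<phi>) \<^bold>\<rightarrow> \<phi>))"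
| L4: "luk_axiom ((\<^bold>\<not> \<phi> \<^bold>\<rightarrow> \<^bold>\<not> \<psi>) \<^bold>\<rightarrow> (\<psi> \<^bold>\<rightarrow> \<phi>))"
| L_bot: "luk_axiom (\<^bold>\<not> \<^bold>\<bottom>)"
| L_oplus1: "luk_axiom ((\<phi> \<^bold>\<oplus> \<psi>) \<^bold>\<rightarrow> (\<^bold>\<not> \<phi> \<^bold>\<rightarrow> \<psi>))"
| L_oplus2: "luk_axiom ((\<^bold>\<not> \<phi> \<^bold>\<rightarrow> \<psi>) \<^bold>\<rightarrow> (\<phi> \<^bold>\<oplus> \<psi>))"

inductive luk_thm :: "'a fm \<Rightarrow> bool" (\<open>\<turnstile>\<^sub>L _\<close> [50] 50) where
  luk_ax: "luk_axiom \<phi> \<Longrightarrow> \<turnstile>\<^sub>L \<phi>"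
| luk_mp: "\<turnstile>\<^sub>L \<phi> \<Longrightarrow> \<turnstile>\<^sub>L \<phi> \<^bold>\<rightarrow> \<psi> \<Longrightarrow> \<turnstile>\<^sub>L \<psi>"

primrec subst :: "('a \<Rightarrow> 'b fm) \<Rightarrow> 'a fm \<Rightarrow> 'b fm" where
  "subst \<sigma> (Atom a) = \<sigma> a"
| "subst \<sigma> \<^bold>\<bottom> = \<^bold>\<bottom>"
| "subst \<sigma> (\<^bold>\<not> \<phi>) = \<^bold>\<not> (subst \<sigma> \<phi>)"
| "subst \<sigma> (\<phi> \<^bold>\<oplus> \<psi>) = subst \<sigma> \<phi> \<^bold>\<oplus> subst \<sigma> \<psi>"


section \<open>The probabilistic logic FP(L,L)\<close>

type_synonym event = "nat fm"

text \<open>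
  A modal formula is a Lukasiewicz formula whose atoms are the formal expressions
  \<open>Pr \<phi>\<close>; such an atom is represented by the event \<open>\<phi>\<close>.  So \<open>atoms \<Phi>\<close> is
  the set of events \<open>\<phi>\<close> for which \<open>Pr \<phi>\<close> occurs in \<open>\<Phi>\<close>.
\<close>

type_synonym mfm = "event fm"

abbreviation Pr :: "event \<Rightarrow> mfm" where
  "Pr \<phi> \<equiv> Atom \<phi>"

inductive fp_thm :: "mfm \<Rightarrow> bool" (\<open>\<turnstile>\<^sub>F\<^sub>P _\<close> [50] 50) where
  fp_luk: "luk_axiom \<Phi> \<Longrightarrow> \<turnstile>\<^sub>F\<^sub>P \<Phi>"
| fp_neg: "\<turnstile>\<^sub>F\<^sub>P \<^bold>\<not> (Pr \<phi>) \<^bold>\<leftrightarrow> Pr (\<^bold>\<not> \<phi>)"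
| fp_imp: "\<turnstile>\<^sub>F\<^sub>P Pr (\<phi> \<^bold>\<rightarrow> \<psi>) \<^bold>\<rightarrow> (Pr \<phi> \<^bold>\<rightarrow> Pr \<psi>)"
| fp_oplus: "\<turnstile>\<^sub>F\<^sub>P Pr (\<phi> \<^bold>\<oplus> \<psi>) \<^bold>\<leftrightarrow> ((Pr \<phi> \<^bold>\<rightarrow> Pr (\<phi> \<^bold>\<odot> \<psi>)) \<^bold>\<rightarrow> Pr \<psi>)"
| fp_nec: "\<turnstile>\<^sub>L \<phi> \<Longrightarrow> \<turnstile>\<^sub>F\<^sub>P Pr \<phi>"
| fp_mp: "\<turnstile>\<^sub>F\<^sub>P \<Phi> \<Longrightarrow> \<turnstile>\<^sub>F\<^sub>P \<Phi> \<^bold>\<rightarrow> \<Psi> \<Longrightarrow> \<turnstile>\<^sub>F\<^sub>P \<Psi>"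


section \<open>Probabilistic unification\<close>

text \<open>
  A problem is a finite set \<open>A\<close> of events, giving the available atoms \<open>Pr \<phi>\<close>, together
  with a finite set of equations between modal formulas over these atoms.
\<close>

type_synonym problem = "event set \<times> (mfm \<times> mfm) set"

definition is_problem :: "problem \<Rightarrow> bool" where
  "is_problem I \<longleftrightarrow> finite (fst I) \<and> finite (snd I) \<and>
     (\<forall>(t, u) \<in> snd I. atoms t \<subseteq> fst I \<and> atoms u \<subseteq> fst I)"

text \<open>
  Substitutions with domain \<open>{Pr \<phi> | \<phi>. \<phi> \<in> A}\<close> are total functions whose values outside
  \<open>A\<close> are never used.
\<close>

type_synonym msubst = "event \<Rightarrow> mfm"

definition prob_subst :: "event set \<Rightarrow> msubst \<Rightarrow> bool" where
  "prob_subst A \<sigma> \<longleftrightarrow>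
     (\<forall>\<Phi> \<Psi>. atoms \<Phi> \<subseteq> A \<longrightarrow> atoms \<Psi> \<subseteq> A \<longrightarrow>
        (\<turnstile>\<^sub>F\<^sub>P \<Phi> \<^bold>\<leftrightarrow> \<Psi>) \<longrightarrow> (\<turnstile>\<^sub>F\<^sub>P subst \<sigma> \<Phi> \<^bold>\<leftrightarrow> subst \<sigma> \<Psi>))"

definition unifiers :: "problem \<Rightarrow> msubst set" where
  "unifiers I = {\<sigma>. prob_subst (fst I) \<sigma> \<and>
     (\<forall>(t, u) \<in> snd I. \<turnstile>\<^sub>F\<^sub>P subst \<sigma> t \<^bold>\<leftrightarrow> subst \<sigma> u)}"

definition less_general :: "event set \<Rightarrow> msubst \<Rightarrow> msubst \<Rightarrow> bool" where
  "less_general A \<sigma> \<tau> \<longleftrightarrow>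
     (\<exists>\<delta>. prob_subst (\<Union>\<phi>\<in>A. atoms (\<tau> \<phi>)) \<delta> \<and>
        (\<forall>t. atoms t \<subseteq> A \<longrightarrow> (\<turnstile>\<^sub>F\<^sub>P subst \<sigma> t \<^bold>\<leftrightarrow> subst \<delta> (subst \<tau> t))))"

text \<open>
  The domain of the factor \<open>\<delta>\<close> in \<open>less_general\<close> depends on the atoms that occur in \<open>\<tau>\<close>,
  and the factor witnessing a first comparison need not extend to the new atoms introduced by
  the factor of a second one; so \<open>less_general\<close> can fail to be transitive.  We therefore work
  with the preorder it generates on the unifiers, which is \<open>less_general\<close> itself as soon as
  the latter is a preorder.
\<close>

definition unifier_preorder :: "problem \<Rightarrow> (msubst \<times> msubst) set" where
  "unifier_preorder I =
     {(\<sigma>, \<tau>). \<sigma> \<in> unifiers I \<and> \<tau> \<in> unifiers I \<and> less_general (fst I) \<sigma> \<tau>}\<^sup>*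
       \<inter> unifiers I \<times> unifiers I"

definition unifier_equiv :: "problem \<Rightarrow> (msubst \<times> msubst) set" where
  "unifier_equiv I = unifier_preorder I \<inter> (unifier_preorder I)\<inverse>"

definition unifier_poset :: "problem \<Rightarrow> msubst set set" where
  "unifier_poset I = unifiers I // unifier_equiv I"

definition unifier_class_le :: "problem \<Rightarrow> msubst set \<Rightarrow> msubst set \<Rightarrow> bool" where
  "unifier_class_le I X Y \<longleftrightarrow> (\<exists>\<sigma>\<in>X. \<exists>\<tau>\<in>Y. (\<sigma>, \<tau>) \<in> unifier_preorder I)"

lemma equiv_unifier_equiv: "equiv (unifiers I) (unifier_equiv I)"
  unfolding unifier_equiv_def unifier_preorder_def
  by (rule equivI) (auto simp: refl_on_def intro!: symI transI)

lemma unifier_class_le_classes: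
  assumes "\<sigma> \<in> unifiers I" "\<tau> \<in> unifiers I"
  shows "unifier_class_le I (unifier_equiv I `` {\<sigma>}) (unifier_equiv I `` {\<tau>})
           \<longleftrightarrow> (\<sigma>, \<tau>) \<in> unifier_preorder I"
  using assms unfolding unifier_class_le_def unifier_equiv_def unifier_preorder_def
  by (auto intro: rtrancl_trans)


section \<open>Unification types\<close>

datatype unif_type = Unitary | Finitary | Infinitary | Nullary

primrec badness :: "unif_type \<Rightarrow> nat" where
  "badness Unitary = 0"
| "badness Finitary = 1"
| "badness Infinitary = 2"
| "badness Nullary = 3"

instantiation unif_type :: linorder
begin

definition less_eq_unif_type :: "unif_type \<Rightarrow> unif_type \<Rightarrow> bool" where
  "s \<le> t \<longleftrightarrow> badness s \<le> badness t"

definition less_unif_type :: "unif_type \<Rightarrow> unif_type \<Rightarrow> bool" where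
  "s < t \<longleftrightarrow> badness s < badness t"

instance
proof
  fix s t :: unif_type
  assume "s \<le> t" "t \<le> s"
  then show "s = t"
    by (cases s; cases t) (simp_all add: less_eq_unif_type_def)
qed (auto simp: less_eq_unif_type_def less_unif_type_def)

end

definition maximal_elements :: "'a set \<Rightarrow> ('a \<Rightarrow> 'a \<Rightarrow> bool) \<Rightarrow> 'a set" where
  "maximal_elements X le = {m \<in> X. \<forall>x\<in>X. le m x \<longrightarrow> x = m}"

text \<open>
  ``Finitely many maximal elements'' means a positive finite number of them, so a nonempty poset
  is of nullary type exactly if it has no maximal element.
\<close>

definition poset_type :: "'a set \<Rightarrow> ('a \<Rightarrow> 'a \<Rightarrow> bool) \<Rightarrow> unif_type" where
  "poset_type X le =
     (let M = maximal_elements X le in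
      if \<exists>m\<in>X. \<forall>x\<in>X. le x m then Unitary
      else if finite M \<and> M \<noteq> {} then Finitary
      else if infinite M then Infinitary
      else Nullary)"

definition problem_type :: "problem \<Rightarrow> unif_type" where
  "problem_type I = poset_type (unifier_poset I) (unifier_class_le I)"

text \<open>
  As usual, only problems possessing a unifier are classified: otherwise an unsolvable problem
  such as \<open>\<^bold>\<top> = \<^bold>\<bottom>\<close> would count as nullary.
\<close>

definition FP_unification_type :: unif_type where
  "FP_unification_type = Max {problem_type I | I. is_problem I \<and> unifiers I \<noteq> {}}"

end

theory Submission
  imports Defs "HOL-Analysis.Further_Topology"
begin

text \<open>
Over events that are distinct variables a unifier of \<open>(X \<or> \<not>X) \<or> (Y \<or> \<not>Y) = \<top>\<close> is a pair of
  modal formulas, that is, a map from the convex set of states to the boundary of the unit square.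
  Such a map lifts to the universal cover of the boundary, and, being Lipschitz, moves the lift by
  a bounded amount along segments of states. A factor \<open>\<delta>\<close> pulls segments back to paths of states,
  which can be straightened by convexity, so displacements can only grow with generality. On the
  other hand, rotating the boundary by a fresh variable gives, for every unifier, a more general one
  whose displacements exceed those of the first by a quarter turn. Hence no unifier is maximal.
\<close>

section \<open>MV-algebra arithmetic up to prelinearity\<close>

section \<open>MV-algebras\<close>

text \<open>Derivability is needed in two opposite directions, and no completeness theorem for FP is
  invoked. That a rotated pair is again a unifier has to be derived, so it is checked algebraically
  in the Lindenbaum algebra of modal formulas, with prime filters deciding on which side of the
  square a point lies. That a factor pulls states back is semantic: it only yields values on the
  atoms in its domain, which must then be extended to genuine states. The extension is a real
  valuation of the chain modulo a prime filter; obtaining such valuations is the purpose of the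
  carry arithmetic. Distinct variables as events make every pair of modal formulas a probabilistic
  substitution, since an FP theorem over such atoms is a Lukasiewicz theorem. The quarter turn is
  the side length of the square, a quarter of its perimeter, swept while the fresh variable runs
  from 0 to 1. The invariant is a set of displacements compared by inclusion, so it survives chains
  of comparisons, as a generated preorder requires.\<close>

class mv_algebra =
  fixes mv_zero :: 'a (\<open>\<zero>\<close>)
    and mv_neg :: "'a \<Rightarrow> 'a" (\<open>\<sim> _\<close> [80] 80)
    and mv_plus :: "'a \<Rightarrow> 'a \<Rightarrow> 'a" (infixl \<open>\<oplus>\<close> 65)
  assumes mv_assoc: "(x \<oplus> y) \<oplus> z = x \<oplus> (y \<oplus> z)"
    and mv_commute: "x \<oplus> y = y \<oplus> x"
    and mv_plus_zero [simp]: "x \<oplus> \<zero> = x"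
    and mv_neg_neg [simp]: "\<sim> \<sim> x = x"
    and mv_plus_neg_zero [simp]: "x \<oplus> \<sim> \<zero> = \<sim> \<zero>"
    and mv_luk: "\<sim> (\<sim> x \<oplus> y) \<oplus> y = \<sim> (\<sim> y \<oplus> x) \<oplus> x"
begin

definition mv_one :: 'a (\<open>\<one>\<close>) where "\<one> = \<sim> \<zero>"
definition mv_times :: "'a \<Rightarrow> 'a \<Rightarrow> 'a" (infixl \<open>\<otimes>\<close> 70) where "x \<otimes> y = \<sim> (\<sim> x \<oplus> \<sim> y)"
definition mv_sup :: "'a \<Rightarrow> 'a \<Rightarrow> 'a" (infixl \<open>\<squnion>\<close> 60) where "x \<squnion> y = \<sim> (\<sim> x \<oplus> y) \<oplus> y"
definition mv_le :: "'a \<Rightarrow> 'a \<Rightarrow> bool" (infix \<open>\<preceq>\<close> 50) where "x \<preceq> y \<longleftrightarrow> \<sim> x \<oplus> y = \<one>"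

lemma mv_left_commute: "x \<oplus> (y \<oplus> z) = y \<oplus> (x \<oplus> z)"
  by (metis mv_assoc mv_commute)

lemmas mv_ac = mv_assoc mv_commute mv_left_commute

lemma mv_zero_plus [simp]: "\<zero> \<oplus> x = x"
  by (metis mv_commute mv_plus_zero)

lemma mv_plus_one [simp]: "x \<oplus> \<one> = \<one>" "\<one> \<oplus> x = \<one>"
  by (simp_all add: mv_one_def mv_commute[of "\<sim> \<zero>"])

lemma mv_neg_zero [simp]: "\<sim> \<zero> = \<one>" and mv_neg_one [simp]: "\<sim> \<one> = \<zero>"
  by (simp_all add: mv_one_def)

lemma mv_plus_neg [simp]: "x \<oplus> \<sim> x = \<one>" "\<sim> x \<oplus> x = \<one>"
proof -
  have "\<sim> (\<sim> \<one> \<oplus> x) \<oplus> x = \<sim> (\<sim> x \<oplus> \<one>) \<oplus> \<one>" by (rule mv_luk)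
  then show "\<sim> x \<oplus> x = \<one>" by simp
  then show "x \<oplus> \<sim> x = \<one>" by (simp add: mv_commute)
qed

lemma mv_times_assoc: "(x \<otimes> y) \<otimes> z = x \<otimes> (y \<otimes> z)"
  and mv_times_commute: "x \<otimes> y = y \<otimes> x"
  and mv_neg_times: "\<sim> (x \<otimes> y) = \<sim> x \<oplus> \<sim> y"
  and mv_neg_plus: "\<sim> (x \<oplus> y) = \<sim> x \<otimes> \<sim> y"
  by (simp_all add: mv_times_def mv_ac)

lemma mv_times_left_commute: "x \<otimes> (y \<otimes> z) = y \<otimes> (x \<otimes> z)"
  by (simp add: mv_times_def mv_ac)

lemmas mv_times_ac = mv_times_assoc mv_times_commute mv_times_left_commute

lemma mv_times_unit [simp]: "x \<otimes> \<one> = x" "\<one> \<otimes> x = x" "x \<otimes> \<zero> = \<zero>" "\<zero> \<otimes> x = \<zero>"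
  "x \<otimes> \<sim> x = \<zero>" "\<sim> x \<otimes> x = \<zero>"
  by (simp_all add: mv_times_def)

lemma mv_le_refl [simp]: "x \<preceq> x" and mv_zero_le [simp]: "\<zero> \<preceq> x" and mv_le_one [simp]: "x \<preceq> \<one>"
  by (simp_all add: mv_le_def)

lemma mv_le_antisym: "x \<preceq> y \<Longrightarrow> y \<preceq> x \<Longrightarrow> x = y"
  using mv_luk[of x y] by (simp add: mv_le_def)

lemma mv_le_iff_plus: "x \<preceq> y \<longleftrightarrow> (\<exists>z. y = x \<oplus> z)"
proof
  assume "x \<preceq> y"
  then have "y = x \<oplus> \<sim> (\<sim> y \<oplus> x)"
    using mv_luk[of x y] by (simp add: mv_le_def mv_commute)
  then show "\<exists>z. y = x \<oplus> z" by blast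
next
  assume "\<exists>z. y = x \<oplus> z"
  then show "x \<preceq> y" by (auto simp: mv_le_def mv_assoc[symmetric])
qed

lemma mv_le_trans: "x \<preceq> y \<Longrightarrow> y \<preceq> z \<Longrightarrow> x \<preceq> z"
  by (metis mv_le_iff_plus mv_assoc)

lemma mv_plus_mono: "x \<preceq> x' \<Longrightarrow> y \<preceq> y' \<Longrightarrow> x \<oplus> y \<preceq> x' \<oplus> y'"
proof -
  assume "x \<preceq> x'" "y \<preceq> y'"
  then obtain u v where "x' = x \<oplus> u" "y' = y \<oplus> v" by (auto simp: mv_le_iff_plus)
  then have "x' \<oplus> y' = (x \<oplus> y) \<oplus> (u \<oplus> v)" by (simp add: mv_ac)
  then show ?thesis by (auto simp: mv_le_iff_plus)
qed

lemma mv_neg_le: "\<sim> x \<preceq> \<sim> y \<longleftrightarrow> y \<preceq> x"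
  by (simp add: mv_le_def mv_commute)

lemma mv_times_mono: "x \<preceq> x' \<Longrightarrow> y \<preceq> y' \<Longrightarrow> x \<otimes> y \<preceq> x' \<otimes> y'"
  by (simp add: mv_times_def mv_neg_le mv_plus_mono)

lemma mv_le_plus: "x \<preceq> x \<oplus> y" "x \<preceq> y \<oplus> x"
  by (metis mv_le_iff_plus mv_commute)+

lemma mv_times_le: "x \<otimes> y \<preceq> x" "y \<otimes> x \<preceq> x"
proof -
  have *: "\<sim> (\<sim> x \<oplus> z) \<preceq> x" for z
    using mv_neg_le[of "\<sim> x \<oplus> z" "\<sim> x"] by (simp add: mv_le_plus)
  show "x \<otimes> y \<preceq> x" "y \<otimes> x \<preceq> x"
    using * by (simp_all add: mv_times_def mv_commute[of "\<sim> y"])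
qed

lemma mv_residuation: "x \<otimes> y \<preceq> z \<longleftrightarrow> x \<preceq> \<sim> y \<oplus> z"
  by (simp add: mv_le_def mv_times_def mv_assoc)

lemma mv_sup_commute: "x \<squnion> y = y \<squnion> x"
  unfolding mv_sup_def by (rule mv_luk)

lemma mv_le_sup: "x \<preceq> x \<squnion> y" "y \<preceq> x \<squnion> y"
proof -
  show *: "y \<preceq> x \<squnion> y" for x y by (simp add: mv_sup_def mv_le_plus)
  show "x \<preceq> x \<squnion> y" by (subst mv_sup_commute) (rule *)
qed

lemma mv_sup_absorb: "x \<preceq> y \<Longrightarrow> x \<squnion> y = y" "y \<preceq> x \<Longrightarrow> x \<squnion> y = x"
proof -
  show *: "x \<squnion> y = y" if "x \<preceq> y" for x y
    using that by (simp add: mv_le_def mv_sup_def)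
  show "y \<preceq> x \<Longrightarrow> x \<squnion> y = x"
    using *[of y x] by (simp add: mv_sup_commute)
qed

lemma mv_sup_least: assumes "x \<preceq> z" "y \<preceq> z" shows "x \<squnion> y \<preceq> z"
proof -
  have "\<sim> (\<sim> x \<oplus> y) \<preceq> \<sim> (\<sim> z \<oplus> y)"
    using assms by (simp add: mv_neg_le mv_plus_mono)
  then have "x \<squnion> y \<preceq> z \<squnion> y"
    unfolding mv_sup_def by (rule mv_plus_mono) simp
  then show ?thesis using assms by (simp add: mv_sup_absorb)
qed

text \<open>Multiplication by \<open>x\<close> is a left adjoint by \<open>mv_residuation\<close>,
  hence preserves suprema.\<close>

lemma mv_times_sup: "x \<otimes> (y \<squnion> z) = x \<otimes> y \<squnion> x \<otimes> z"
proof (rule mv_le_antisym)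
  have "y \<squnion> z \<preceq> \<sim> x \<oplus> (x \<otimes> y \<squnion> x \<otimes> z)"
    by (rule mv_sup_least) (simp_all add: mv_residuation[symmetric] mv_times_commute[of _ x] mv_le_sup)
  then show "x \<otimes> (y \<squnion> z) \<preceq> x \<otimes> y \<squnion> x \<otimes> z"
    by (simp add: mv_residuation[symmetric] mv_times_commute[of _ x])
qed (simp add: mv_sup_least mv_times_mono mv_le_sup)

lemma mv_divides: assumes "y \<preceq> t" shows "t \<otimes> (\<sim> t \<oplus> y) = y"
proof -
  have "\<sim> y \<squnion> \<sim> t = \<sim> y" using assms by (simp add: mv_sup_absorb mv_neg_le)
  then show ?thesis
    by (simp add: mv_sup_def mv_times_def mv_commute)
qed

lemma mv_modus_ponens: "x \<otimes> (\<sim> x \<oplus> y) \<preceq> y"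
  by (subst mv_times_commute) (simp add: mv_residuation)

lemma mv_inf_commute: "x \<otimes> (\<sim> x \<oplus> y) = y \<otimes> (\<sim> y \<oplus> x)"
proof -
  have "\<sim> x \<oplus> \<sim> (\<sim> x \<oplus> y) = \<sim> y \<oplus> \<sim> (\<sim> y \<oplus> x)"
    using mv_luk[of "\<sim> y" "\<sim> x"] by (simp only: mv_neg_neg mv_commute)
  then show ?thesis by (simp only: mv_times_def)
qed

text \<open>Dually, the differences \<open>P\<close> and \<open>Q\<close> have infimum
  \<open>\<zero>\<close>. This infimum is \<open>P \<otimes> (\<sim> P \<oplus> Q)\<close>, and
  repeated exchanges of the two arguments of an infimum expose a factor
  \<open>\<sim> x \<otimes> x\<close>.\<close>

lemma mv_prelinear: "(\<sim> x \<oplus> y) \<squnion> (\<sim> y \<oplus> x) = \<one>"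
proof -
  define P Q Z where "P = x \<otimes> \<sim> y" and "Q = y \<otimes> \<sim> x" and "Z = \<sim> x \<oplus> Q"
  have P: "\<sim> P = \<sim> x \<oplus> y" and Q: "\<sim> Q = \<sim> y \<oplus> x" and Z: "\<sim> Z = x \<otimes> \<sim> Q"
    by (simp_all add: P_def Q_def Z_def mv_neg_times mv_neg_plus)
  have "P \<otimes> (\<sim> P \<oplus> Q) = x \<otimes> (\<sim> y \<otimes> (\<sim> \<sim> y \<oplus> Z))"
    unfolding P unfolding P_def Z_def by (simp only: mv_times_assoc mv_ac mv_neg_neg)
  also have "\<sim> y \<otimes> (\<sim> \<sim> y \<oplus> Z) = Z \<otimes> (\<sim> Z \<oplus> \<sim> y)"
    by (rule mv_inf_commute)
  also have "x \<otimes> (Z \<otimes> (\<sim> Z \<oplus> \<sim> y)) = (x \<otimes> (\<sim> x \<oplus> Q)) \<otimes> (\<sim> Z \<oplus> \<sim> y)"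
    by (simp add: Z_def mv_times_assoc)
  also have "x \<otimes> (\<sim> x \<oplus> Q) = Q \<otimes> (\<sim> Q \<oplus> x)"
    by (rule mv_inf_commute)
  also have "(Q \<otimes> (\<sim> Q \<oplus> x)) \<otimes> (\<sim> Z \<oplus> \<sim> y) = \<sim> x \<otimes> ((\<sim> Q \<oplus> x) \<otimes> (y \<otimes> (\<sim> y \<oplus> \<sim> Z)))"
    unfolding Q_def by (simp only: mv_times_ac mv_commute)
  also have "y \<otimes> (\<sim> y \<oplus> \<sim> Z) = \<sim> Z \<otimes> (\<sim> \<sim> Z \<oplus> y)"
    by (rule mv_inf_commute)
  also have "\<sim> x \<otimes> ((\<sim> Q \<oplus> x) \<otimes> (\<sim> Z \<otimes> (\<sim> \<sim> Z \<oplus> y)))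
      = (\<sim> x \<otimes> x) \<otimes> ((\<sim> Q \<oplus> x) \<otimes> (\<sim> Q \<otimes> (\<sim> \<sim> Z \<oplus> y)))"
    unfolding Z by (simp only: mv_times_ac)
  also have "\<dots> = \<zero>" by simp
  finally have "\<sim> (P \<otimes> (\<sim> P \<oplus> Q)) = \<one>" by simp
  then have "\<sim> Q \<squnion> \<sim> P = \<one>"
    by (simp only: mv_neg_times mv_sup_def mv_neg_neg mv_commute)
  then show ?thesis by (simp only: P Q mv_sup_commute)
qed

text \<open>Prelinearity for \<open>\<sim> x\<close> and \<open>y\<close>. Modulo a prime filter it
  becomes the dichotomy behind carries: the sum reaches \<open>\<one>\<close> or the excess
  \<open>x \<otimes> y\<close> vanishes.\<close>

lemma mv_plus_or_times: "(x \<oplus> y) \<squnion> \<sim> (x \<otimes> y) = \<one>"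
  using mv_prelinear[of "\<sim> x" y] by (simp only: mv_neg_times mv_neg_neg mv_commute)

lemma mv_sup_idem [simp]: "x \<squnion> x = x"
  by (simp add: mv_sup_absorb)

lemma mv_sup_one [simp]: "x \<squnion> \<one> = \<one>" "\<one> \<squnion> x = \<one>"
  by (simp_all add: mv_sup_absorb)

lemma mv_one_le: "\<one> \<preceq> x \<longleftrightarrow> x = \<one>"
  by (simp add: mv_le_def)

lemma mv_le_impl_trans: "(\<sim> x \<oplus> y) \<otimes> (\<sim> y \<oplus> z) \<preceq> \<sim> x \<oplus> z"
proof -
  have "((\<sim> x \<oplus> y) \<otimes> (\<sim> y \<oplus> z)) \<otimes> x = (x \<otimes> (\<sim> x \<oplus> y)) \<otimes> (\<sim> y \<oplus> z)"
    by (simp only: mv_times_ac)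
  also have "\<dots> \<preceq> y \<otimes> (\<sim> y \<oplus> z)" by (simp add: mv_times_mono mv_modus_ponens)
  finally show ?thesis
    unfolding mv_residuation[symmetric] using mv_modus_ponens by (rule mv_le_trans)
qed

text \<open>Collecting terms leaves \<open>(x \<squnion> y) \<oplus> z \<oplus> \<sim> (x \<oplus>
  z) = \<one>\<close>, which follows from \<open>x \<preceq> x \<squnion> y\<close>. It makes
  \<open>mv_cong\<close> compatible with sums.\<close>

lemma mv_le_impl_plus: "\<sim> x \<oplus> y \<preceq> \<sim> (x \<oplus> z) \<oplus> (y \<oplus> z)"
proof -
  have "(x \<squnion> y) \<oplus> (z \<oplus> \<sim> (x \<oplus> z)) = \<one>"
    using mv_plus_mono[OF mv_le_sup(1)[of x y] mv_le_refl[of "z \<oplus> \<sim> (x \<oplus> z)"]]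
    by (simp add: mv_assoc[symmetric] mv_one_le)
  then show ?thesis by (simp only: mv_le_def mv_sup_def mv_ac)
qed


section \<open>Existence of prime filters\<close>

section \<open>Prime filters\<close>

definition mv_filter :: "'a set \<Rightarrow> bool" where
  "mv_filter F \<longleftrightarrow> \<one> \<in> F \<and> (\<forall>x y. x \<in> F \<longrightarrow> \<sim> x \<oplus> y \<in> F \<longrightarrow> y \<in> F)"

definition mv_prime :: "'a set \<Rightarrow> bool" where
  "mv_prime F \<longleftrightarrow> mv_filter F \<and> \<zero> \<notin> F \<and> (\<forall>x y. x \<squnion> y \<in> F \<longrightarrow> x \<in> F \<or> y \<in> F)"

definition mv_cong :: "'a set \<Rightarrow> 'a \<Rightarrow> 'a \<Rightarrow> bool" where
  "mv_cong F x y \<longleftrightarrow> \<sim> x \<oplus> y \<in> F \<and> \<sim> y \<oplus> x \<in> F"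

lemma mv_filter_up: "mv_filter F \<Longrightarrow> x \<in> F \<Longrightarrow> x \<preceq> y \<Longrightarrow> y \<in> F"
  unfolding mv_filter_def mv_le_def by metis

lemma mv_filter_times: assumes "mv_filter F" "x \<in> F" "y \<in> F" shows "x \<otimes> y \<in> F"
proof -
  have "x \<preceq> \<sim> y \<oplus> x \<otimes> y" by (simp add: mv_residuation[symmetric])
  then show ?thesis using assms mv_filter_up[OF assms(1)] unfolding mv_filter_def by blast
qed

text \<open>These filters are the test extensions in the Zorn argument, in place of the filter
  generated by \<open>F\<close> and a further element.\<close>

lemma mv_filter_sup: assumes F: "mv_filter F" shows "mv_filter {z. z \<squnion> y \<in> F}"
  unfolding mv_filter_def
proof (intro conjI allI impI)
  show "\<one> \<in> {z. z \<squnion> y \<in> F}" using F by (simp add: mv_filter_def)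
  fix z w assume "z \<in> {z. z \<squnion> y \<in> F}" "\<sim> z \<oplus> w \<in> {z. z \<squnion> y \<in> F}"
  then have in_F: "(z \<squnion> y) \<otimes> ((\<sim> z \<oplus> w) \<squnion> y) \<in> F" using F by (simp add: mv_filter_times)
  have "z \<otimes> ((\<sim> z \<oplus> w) \<squnion> y) \<preceq> w \<squnion> y"
    unfolding mv_times_sup
    by (intro mv_sup_least mv_le_trans[OF mv_modus_ponens mv_le_sup(1)]
        mv_le_trans[OF mv_times_le(2) mv_le_sup(2)])
  moreover have "y \<otimes> ((\<sim> z \<oplus> w) \<squnion> y) \<preceq> w \<squnion> y"
    by (rule mv_le_trans[OF mv_times_le(1) mv_le_sup(2)])
  ultimately have "(z \<squnion> y) \<otimes> ((\<sim> z \<oplus> w) \<squnion> y) \<preceq> w \<squnion> y"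
    by (simp add: mv_residuation mv_sup_least)
  then show "w \<in> {z. z \<squnion> y \<in> F}" using F in_F by (auto intro: mv_filter_up)
qed

lemma mv_prime_exists:
  assumes F: "mv_filter F" and e: "e \<notin> F"
  obtains G where "mv_prime G" "F \<subseteq> G" "e \<notin> G"
proof -
  define A where "A = {G. mv_filter G \<and> F \<subseteq> G \<and> e \<notin> G}"
  have "\<exists>M\<in>A. \<forall>X\<in>A. M \<subseteq> X \<longrightarrow> X = M"
  proof (rule subset_Zorn_nonempty)
    show "A \<noteq> {}" using F e by (auto simp: A_def)
    fix C assume C: "C \<noteq> {}" "subset.chain A C"
    have CA: "G \<in> A" if "G \<in> C" for G using C(2) that unfolding subset_chain_def by blast
    have "mv_filter (\<Union>C)"
      unfolding mv_filter_def
    proof (intro conjI allI impI)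
      show "\<one> \<in> \<Union>C" using C(1) CA unfolding A_def mv_filter_def by blast
      fix x y assume "x \<in> \<Union>C" "\<sim> x \<oplus> y \<in> \<Union>C"
      then obtain G where "G \<in> C" "x \<in> G" "\<sim> x \<oplus> y \<in> G"
        using C(2) unfolding subset_chain_def by (metis UnionE subsetD)
      moreover from this have "mv_filter G" using CA unfolding A_def by blast
      ultimately show "y \<in> \<Union>C" unfolding mv_filter_def by blast
    qed
    then show "\<Union>C \<in> A" using C(1) CA unfolding A_def by blast
  qed
  then obtain M where "M \<in> A" and max: "\<forall>X\<in>A. M \<subseteq> X \<longrightarrow> X = M" by blast
  then have M: "mv_filter M" "F \<subseteq> M" "e \<notin> M" unfolding A_def by blast+
  \<comment> \<open>Otherwise the filter of all \<open>z\<close> with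
    \<open>z \<squnion> y \<in> M\<close> would extend \<open>M\<close> by \<open>x\<close> and
    still miss \<open>e\<close>, against maximality.\<close>
  have extend: "e \<squnion> y \<in> M" if "x \<squnion> y \<in> M" "x \<notin> M" for x y
  proof -
    have "M \<subseteq> {z. z \<squnion> y \<in> M}" using mv_filter_up[OF M(1) _ mv_le_sup(1)] by blast
    show ?thesis
    proof (rule ccontr)
      assume "e \<squnion> y \<notin> M"
      then have "{z. z \<squnion> y \<in> M} \<in> A"
        using mv_filter_sup[OF M(1), of y] \<open>M \<subseteq> {z. z \<squnion> y \<in> M}\<close> M(2) unfolding A_def by blast
      then have "{z. z \<squnion> y \<in> M} = M" using max \<open>M \<subseteq> {z. z \<squnion> y \<in> M}\<close> by blast
      then show False using that by blast
    qed
  qed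
  \<comment> \<open>Exchanging first \<open>x\<close> and then \<open>y\<close> for \<open>e\<close>
    would put \<open>e \<squnion> e = e\<close> into \<open>M\<close>.\<close>
  have "x \<in> M \<or> y \<in> M" if "x \<squnion> y \<in> M" for x y
    using extend[of x y] extend[of y e] that M(3) by (auto simp: mv_sup_commute[of e y])
  moreover have "\<zero> \<notin> M" using mv_filter_up[OF M(1) _ mv_zero_le] M(3) by blast
  ultimately have "mv_prime M" using M(1) by (simp add: mv_prime_def)
  then show thesis using M that by blast
qed

end

section \<open>Congruence modulo a filter\<close>

locale mv_filter_locale =
  fixes F :: "'a :: mv_algebra set"
  assumes filter: "mv_filter F"
begin

abbreviation cong (infix \<open>\<doteq>\<close> 50) where "x \<doteq> y \<equiv> mv_cong F x y"

lemma one_in [simp]: "\<one> \<in> F"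
  using filter by (simp add: mv_filter_def)

lemma cong_refl [simp]: "x \<doteq> x"
  by (simp add: mv_cong_def)

lemma cong_sym: "x \<doteq> y \<Longrightarrow> y \<doteq> x"
  by (simp add: mv_cong_def)

lemma cong_trans: "x \<doteq> y \<Longrightarrow> y \<doteq> z \<Longrightarrow> x \<doteq> z"
  unfolding mv_cong_def
  by (blast intro: mv_filter_up[OF filter mv_filter_times[OF filter] mv_le_impl_trans])

lemma cong_mem: "x \<doteq> y \<Longrightarrow> x \<in> F \<longleftrightarrow> y \<in> F"
  using filter by (auto simp: mv_cong_def mv_filter_def)

lemma cong_neg: "x \<doteq> y \<Longrightarrow> \<sim> x \<doteq> \<sim> y"
  by (simp add: mv_cong_def mv_commute)

lemma cong_plus: assumes "x \<doteq> x'" "y \<doteq> y'" shows "x \<oplus> y \<doteq> x' \<oplus> y'"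
proof (rule cong_trans)
  show "x \<oplus> y \<doteq> x' \<oplus> y" 
    using assms unfolding mv_cong_def by (blast intro: mv_filter_up[OF filter _ mv_le_impl_plus])
  show "x' \<oplus> y \<doteq> x' \<oplus> y'"
    using assms unfolding mv_cong_def mv_commute[of x' y] mv_commute[of x' y']
    by (blast intro: mv_filter_up[OF filter _ mv_le_impl_plus])
qed

lemma cong_times: "x \<doteq> x' \<Longrightarrow> y \<doteq> y' \<Longrightarrow> x \<otimes> y \<doteq> x' \<otimes> y'"
  by (simp add: mv_times_def cong_neg cong_plus)

lemma cong_sup: "x \<doteq> x' \<Longrightarrow> y \<doteq> y' \<Longrightarrow> x \<squnion> y \<doteq> x' \<squnion> y'"
  by (simp add: mv_sup_def cong_neg cong_plus)

lemma cong_one: "x \<doteq> \<one> \<longleftrightarrow> x \<in> F" and cong_zero: "x \<doteq> \<zero> \<longleftrightarrow> \<sim> x \<in> F"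
  by (simp_all add: mv_cong_def)

end

section \<open>Carry arithmetic in the chain modulo a prime filter\<close>

section \<open>Prime filters have real valuations\<close>

lemma (in mv_algebra) mv_plus_times_neg: assumes "n \<preceq> p" shows "p \<otimes> \<sim> n \<oplus> n = p"
  using assms mv_sup_absorb(2)[of n p] by (simp add: mv_sup_def mv_times_def)

text \<open>On the unit interval this is \<open>a + p + q - 1\<close> clamped to [0, 1]: the second
  of the three unit layers of the sum, between the layers \<open>a \<oplus> p \<oplus> q\<close> and
  \<open>a \<otimes> p \<otimes> q\<close>.\<close>

definition mv_mid :: "'a::mv_algebra \<Rightarrow> 'a \<Rightarrow> 'a \<Rightarrow> 'a" where
  "mv_mid a p q = a \<otimes> p \<oplus> (a \<oplus> p) \<otimes> q"

lemma mv_mid_comm: "mv_mid a p q = mv_mid p a q"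
  by (simp add: mv_mid_def mv_times_commute mv_commute)

text \<open>Both sides are the sum of \<open>n\<close> and the differences of \<open>p\<close> and
  \<open>q\<close> from \<open>n\<close>.\<close>

lemma mv_mid_swap_above:
  assumes "n \<preceq> p" "n \<preceq> q"
  shows "\<sim> n \<otimes> p \<oplus> q = \<sim> n \<otimes> q \<oplus> p"
proof -
  have "p \<otimes> \<sim> n \<oplus> (q \<otimes> \<sim> n \<oplus> n) = (p \<otimes> \<sim> n \<oplus> n) \<oplus> q \<otimes> \<sim> n" by (simp only: mv_ac)
  then show ?thesis
    unfolding mv_plus_times_neg[OF assms(1)] mv_plus_times_neg[OF assms(2)]
    by (simp only: mv_times_commute mv_commute)
qed

text \<open>With gaps \<open>r\<close> from \<open>n\<close> up to \<open>p\<close> and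
  \<open>m\<close> from \<open>q\<close> up to \<open>n\<close>, removing \<open>m\<close> from
  \<open>r \<oplus> m \<oplus> q\<close> gives back \<open>r \<oplus> q\<close>, because nothing is
  truncated.\<close>

lemma mv_mid_swap_between:
  assumes "q \<preceq> n" "n \<preceq> p"
  shows "\<sim> n \<otimes> p \<oplus> q = (\<sim> n \<oplus> q) \<otimes> p"
proof -
  define r m where "r = \<sim> n \<otimes> p" and "m = n \<otimes> \<sim> q"
  have p: "p = r \<oplus> n" using mv_plus_times_neg[OF assms(2)] by (simp add: r_def mv_times_commute)
  have n: "n = m \<oplus> q" using mv_plus_times_neg[OF assms(1)] by (simp add: m_def)
  have neg_m: "\<sim> m = \<sim> n \<oplus> q" by (simp add: m_def mv_neg_times)
  have "r \<oplus> q \<preceq> \<sim> m"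
    unfolding neg_m r_def by (simp add: mv_plus_mono mv_times_le)
  then have "\<sim> m \<otimes> (\<sim> \<sim> m \<oplus> (r \<oplus> q)) = r \<oplus> q" by (rule mv_divides)
  moreover have "\<sim> \<sim> m \<oplus> (r \<oplus> q) = r \<oplus> (m \<oplus> q)" by (simp only: mv_neg_neg mv_ac)
  then have "\<sim> \<sim> m \<oplus> (r \<oplus> q) = p" by (simp only: p n[symmetric])
  ultimately show ?thesis by (simp add: neg_m r_def)
qed

lemma mv_mid_swap_exact:
  assumes "n \<preceq> p \<or> p \<preceq> n" "n \<preceq> q \<or> q \<preceq> n"
  shows "mv_mid (\<sim> n) p q = mv_mid (\<sim> n) q p"
proof -
  have above: "\<sim> n \<oplus> x = \<one>" if "n \<preceq> x" for x using that by (simp add: mv_le_def)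
  have below: "\<sim> n \<otimes> x = \<zero>" if "x \<preceq> n" for x
    using that by (simp add: mv_le_def mv_times_def mv_commute)
  consider "n \<preceq> p" "n \<preceq> q" | "n \<preceq> p" "q \<preceq> n" | "p \<preceq> n" "n \<preceq> q" | "p \<preceq> n" "q \<preceq> n"
    using assms by blast
  then show ?thesis
  proof cases
    case 1
    then show ?thesis using mv_mid_swap_above[of n p q] by (simp add: mv_mid_def above)
  next
    case 2
    then show ?thesis using mv_mid_swap_between[of q n p] by (simp add: mv_mid_def above below)
  next
    case 3
    then show ?thesis using mv_mid_swap_between[of p n q] by (simp add: mv_mid_def above below)
  next
    case 4
    \<comment> \<open>De Morgan dual of the case where both elements lie above
      \<open>n\<close>.\<close>
    have "\<sim> (\<sim> \<sim> n \<otimes> \<sim> p \<oplus> \<sim> q) = \<sim> (\<sim> \<sim> n \<otimes> \<sim> q \<oplus> \<sim> p)"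
      using 4 mv_mid_swap_above[of "\<sim> n" "\<sim> p" "\<sim> q"] by (simp add: mv_neg_le)
    then have "(\<sim> n \<oplus> p) \<otimes> q = (\<sim> n \<oplus> q) \<otimes> p"
      by (simp add: mv_times_def)
    then show ?thesis using 4 by (simp add: mv_mid_def below)
  qed
qed

locale mv_prime_locale =
  fixes F :: "'a :: mv_algebra set"
  assumes prime: "mv_prime F"
begin

sublocale mv_filter_locale F
  using prime by unfold_locales (simp add: mv_prime_def)

lemma zero_notin [simp]: "\<zero> \<notin> F"
  using prime by (simp add: mv_prime_def)

lemma primeD: "x \<squnion> y \<in> F \<Longrightarrow> x \<in> F \<or> y \<in> F"
  using prime by (simp add: mv_prime_def)

lemma notin_down: "y \<notin> F \<Longrightarrow> x \<preceq> y \<Longrightarrow> x \<notin> F"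
  using mv_filter_up[OF filter] by blast

lemma plus_or_times: "x \<oplus> y \<in> F \<or> x \<otimes> y \<doteq> \<zero>"
  using primeD[of "x \<oplus> y" "\<sim> (x \<otimes> y)"] by (simp add: mv_plus_or_times cong_zero)

text \<open>The quotient is a chain only up to congruence. The supremum or infimum with
  \<open>n\<close> is a representative comparable with \<open>n\<close> in the algebra itself, where
  the exact swap law applies.\<close>

lemma cong_comparable: "\<exists>p'. p \<doteq> p' \<and> (n \<preceq> p' \<or> p' \<preceq> n)"
proof -
  consider "\<sim> n \<oplus> p \<in> F" | "\<sim> p \<oplus> n \<in> F"
    using primeD[of "\<sim> n \<oplus> p" "\<sim> p \<oplus> n"] by (auto simp: mv_prelinear)
  then show ?thesis
  proof cases
    case 1
    then have "\<sim> (\<sim> n \<oplus> p) \<oplus> p \<doteq> \<sim> \<one> \<oplus> p"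
      by (intro cong_plus cong_neg) (simp_all add: cong_one)
    then have "p \<doteq> n \<squnion> p" by (simp add: mv_sup_def cong_sym)
    then show ?thesis using mv_le_sup by blast
  next
    case 2
    then have "p \<otimes> (\<sim> p \<oplus> n) \<doteq> p \<otimes> \<one>"
      by (intro cong_times) (simp_all add: cong_one)
    then have "p \<doteq> n \<otimes> (\<sim> n \<oplus> p)" by (simp add: cong_sym mv_inf_commute[of n])
    then show ?thesis using mv_times_le by blast
  qed
qed

lemma mid_cong: "a \<doteq> a' \<Longrightarrow> p \<doteq> p' \<Longrightarrow> q \<doteq> q' \<Longrightarrow> mv_mid a p q \<doteq> mv_mid a' p' q'"
  unfolding mv_mid_def by (intro cong_plus cong_times)

lemma mid_swap: "mv_mid a p q \<doteq> mv_mid a q p"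
proof -
  obtain p' q' where *: "p \<doteq> p'" "\<sim> a \<preceq> p' \<or> p' \<preceq> \<sim> a" "q \<doteq> q'" "\<sim> a \<preceq> q' \<or> q' \<preceq> \<sim> a"
    using cong_comparable by meson
  have "mv_mid a p q \<doteq> mv_mid a p' q'" using * by (simp add: mid_cong)
  also have "mv_mid a p' q' = mv_mid a q' p'"
    using mv_mid_swap_exact[of "\<sim> a" p' q'] * by simp
  finally show ?thesis
    using * by (meson cong_refl cong_sym cong_trans mid_cong)
qed

text \<open>
  A pair \<open>(k, a)\<close> stands for \<open>k + a\<close> in the ordered group of the chain modulo \<open>F\<close>; adding \<open>p\<close>
  produces a carry precisely when \<open>a + p\<close> reaches \<open>1\<close>.
\<close>

definition step :: "'a \<Rightarrow> nat \<times> 'a \<Rightarrow> nat \<times> 'a" where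
  "step p z = (if snd z \<oplus> p \<in> F then (Suc (fst z), snd z \<otimes> p) else (fst z, snd z \<oplus> p))"

definition peq :: "nat \<times> 'a \<Rightarrow> nat \<times> 'a \<Rightarrow> bool" (infix \<open>\<simeq>\<close> 50) where
  "y \<simeq> z \<longleftrightarrow> fst y = fst z \<and> snd y \<doteq> snd z"

definition ple :: "nat \<times> 'a \<Rightarrow> nat \<times> 'a \<Rightarrow> bool" (infix \<open>\<sqsubseteq>\<close> 50) where
  "y \<sqsubseteq> z \<longleftrightarrow> fst y < fst z \<or> fst y = fst z \<and> \<sim> (snd y) \<oplus> snd z \<in> F"

text \<open>The normal form of \<open>k + s\<close> for \<open>s\<close> in [0, 3] given by its
  three unit layers: each of the first two layers that is full contributes a unit, and the next one
  supplies the fraction.\<close>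

definition norm3 :: "nat \<Rightarrow> 'a \<Rightarrow> 'a \<Rightarrow> 'a \<Rightarrow> nat \<times> 'a" where
  "norm3 k s\<^sub>1 s\<^sub>2 s\<^sub>3 = (if s\<^sub>1 \<notin> F then (k, s\<^sub>1) else if s\<^sub>2 \<notin> F then (Suc k, s\<^sub>2) else (Suc (Suc k), s\<^sub>3))"

lemma peq_refl [simp]: "z \<simeq> z"
  by (simp add: peq_def)

lemma peq_sym: "y \<simeq> z \<Longrightarrow> z \<simeq> y"
  by (auto simp: peq_def intro: cong_sym)

lemma peq_trans [trans]: "x \<simeq> y \<Longrightarrow> y \<simeq> z \<Longrightarrow> x \<simeq> z"
  by (auto simp: peq_def intro: cong_trans)

lemma step_cong: assumes "y \<simeq> z" shows "step p y \<simeq> step p z"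
proof -
  have "snd y \<oplus> p \<doteq> snd z \<oplus> p" "snd y \<otimes> p \<doteq> snd z \<otimes> p"
    using assms by (simp_all add: peq_def cong_plus cong_times)
  then show ?thesis using assms cong_mem[of "snd y \<oplus> p"] by (auto simp: peq_def step_def)
qed

lemma norm3_cong: "s\<^sub>2 \<doteq> s\<^sub>2' \<Longrightarrow> norm3 k s\<^sub>1 s\<^sub>2 s\<^sub>3 \<simeq> norm3 k s\<^sub>1 s\<^sub>2' s\<^sub>3"
  using cong_mem[of s\<^sub>2 s\<^sub>2'] by (simp add: norm3_def peq_def)

text \<open>Modulo \<open>F\<close>, two additions depend on the order of \<open>p\<close> and
  \<open>q\<close> only through the middle layer, where \<open>mid_swap\<close> removes the
  dependence.\<close>

lemma step_step: "step q (step p (k, a)) \<simeq> norm3 k (a \<oplus> p \<oplus> q) (mv_mid a p q) (a \<otimes> p \<otimes> q)"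
proof (cases "a \<oplus> p \<in> F")
  case True
  then have "(a \<oplus> p) \<otimes> q \<doteq> \<one> \<otimes> q" by (intro cong_times) (simp_all add: cong_one)
  then have mid: "mv_mid a p q \<doteq> a \<otimes> p \<oplus> q" by (simp add: mv_mid_def cong_plus)
  have "a \<oplus> p \<oplus> q \<in> F" using True mv_filter_up[OF filter] mv_le_plus by blast
  then show ?thesis
    using True mid cong_mem[OF mid] by (simp add: step_def norm3_def peq_def cong_sym)
next
  case False
  then have "a \<otimes> p \<doteq> \<zero>" using plus_or_times by blast
  then have "mv_mid a p q \<doteq> \<zero> \<oplus> (a \<oplus> p) \<otimes> q" unfolding mv_mid_def by (intro cong_plus) simp_all
  then have mid: "mv_mid a p q \<doteq> (a \<oplus> p) \<otimes> q" by simp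
  have "(a \<oplus> p) \<otimes> q \<notin> F" using False notin_down mv_times_le by blast
  then show ?thesis
    using False mid cong_mem[OF mid] by (simp add: step_def norm3_def peq_def cong_sym)
qed

lemma step_commute: "step q (step p z) \<simeq> step p (step q z)"
proof -
  obtain k a where z: "z = (k, a)" by (cases z)
  have "step q (step p z) \<simeq> norm3 k (a \<oplus> p \<oplus> q) (mv_mid a p q) (a \<otimes> p \<otimes> q)"
    unfolding z by (rule step_step)
  also have "\<dots> \<simeq> norm3 k (a \<oplus> p \<oplus> q) (mv_mid a q p) (a \<otimes> p \<otimes> q)"
    by (intro norm3_cong mid_swap)
  also have "\<dots> = norm3 k (a \<oplus> q \<oplus> p) (mv_mid a q p) (a \<otimes> q \<otimes> p)"
    by (simp only: mv_ac mv_times_ac)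
  also have "\<dots> \<simeq> step p (step q z)"
    unfolding z by (rule peq_sym[OF step_step])
  finally show ?thesis .
qed

lemma mid_rotate: "mv_mid d a b \<doteq> mv_mid a b d"
  using mid_swap[of a d b] by (simp add: mv_mid_comm[of d a])

text \<open>The condition on \<open>snd z\<close> excludes \<open>(k, \<one>)\<close>, a second name
  for \<open>(Suc k, \<zero>)\<close>, from which the two sides could end in different
  representatives of one value.\<close>

lemma step_plus:
  assumes d: "snd z \<notin> F" and ab: "a \<otimes> b \<doteq> \<zero>"
  shows "step b (step a z) \<simeq> step (a \<oplus> b) z"
proof -
  obtain k d where z: "z = (k, d)" by (cases z)
  have "mv_mid a b d \<doteq> \<zero> \<oplus> (a \<oplus> b) \<otimes> d"
    unfolding mv_mid_def using ab by (intro cong_plus) simp_all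
  then have mid: "mv_mid d a b \<doteq> d \<otimes> (a \<oplus> b)"
    using cong_trans[OF mid_rotate] by (simp add: mv_times_commute)
  have "d \<otimes> (a \<oplus> b) \<notin> F" using d notin_down mv_times_le z by (metis snd_conv)
  then have "norm3 k (d \<oplus> a \<oplus> b) (mv_mid d a b) (d \<otimes> a \<otimes> b) \<simeq> step (a \<oplus> b) z"
    using mid cong_mem[OF mid] by (simp add: z step_def norm3_def peq_def mv_assoc)
  then show ?thesis using step_step peq_trans z by blast
qed

lemma step_carry:
  assumes ab: "a \<oplus> b \<in> F"
  shows "step b (step a (k, d)) \<simeq> step (a \<otimes> b) (Suc k, d)"
proof -
  have "(a \<oplus> b) \<otimes> d \<doteq> \<one> \<otimes> d" using ab by (intro cong_times) (simp_all add: cong_one)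
  then have "mv_mid a b d \<doteq> a \<otimes> b \<oplus> d" by (simp add: mv_mid_def cong_plus)
  then have mid: "mv_mid d a b \<doteq> d \<oplus> a \<otimes> b"
    using cong_trans[OF mid_rotate] by (simp add: mv_commute)
  have "d \<oplus> a \<oplus> b \<in> F" using ab mv_filter_up[OF filter] mv_le_plus(2) mv_assoc by metis
  then have "norm3 k (d \<oplus> a \<oplus> b) (mv_mid d a b) (d \<otimes> a \<otimes> b) \<simeq> step (a \<otimes> b) (Suc k, d)"
    using mid cong_mem[OF mid] by (simp add: step_def norm3_def peq_def mv_times_assoc)
  then show ?thesis using step_step peq_trans by blast
qed

lemma steps_step: "(step p ^^ n) (step q z) \<simeq> step q ((step p ^^ n) z)"
proof (induction n)
  case (Suc n)
  then have "step p ((step p ^^ n) (step q z)) \<simeq> step p (step q ((step p ^^ n) z))"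
    by (rule step_cong)
  also have "\<dots> \<simeq> step q (step p ((step p ^^ n) z))" by (rule step_commute)
  finally show ?case by simp
qed simp

text \<open>Commutativity sorts alternating additions into blocks, whose integer parts can be
  estimated separately.\<close>

lemma steps_compose: "((\<lambda>z. step b (step a z)) ^^ n) z \<simeq> (step b ^^ n) ((step a ^^ n) z)"
proof (induction n)
  case (Suc n)
  then have "step b (step a (((\<lambda>z. step b (step a z)) ^^ n) z))
      \<simeq> step b (step a ((step b ^^ n) ((step a ^^ n) z)))"
    by (intro step_cong)
  also have "\<dots> \<simeq> step b ((step b ^^ n) (step a ((step a ^^ n) z)))"
    by (intro step_cong peq_sym[OF steps_step])
  finally show ?case by simp
qed simp

lemma step_shift: "step p (j + k, a) = (j + fst (step p (k, a)), snd (step p (k, a)))"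
  by (simp add: step_def)

lemma steps_shift:
  "(step p ^^ n) (j + k, a) = (j + fst ((step p ^^ n) (k, a)), snd ((step p ^^ n) (k, a)))"
  by (induction n) (simp_all add: step_shift)

lemma step_proper: "snd z \<notin> F \<Longrightarrow> snd (step p z) \<notin> F"
  using notin_down mv_times_le(1) by (auto simp: step_def)

lemma steps_proper: "snd z \<notin> F \<Longrightarrow> snd ((step p ^^ n) z) \<notin> F"
  by (induction n) (simp_all add: step_proper)

lemma step_mono: assumes "y \<sqsubseteq> z" shows "step p y \<sqsubseteq> step p z"
proof -
  obtain k a l b where y: "y = (k, a)" and z: "z = (l, b)" by (cases y, cases z)
  consider "k = l" "\<sim> a \<oplus> b \<in> F" | "k < l" using assms by (auto simp: ple_def y z)
  then show ?thesis
  proof cases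
    case 1
    have plus: "\<sim> (a \<oplus> p) \<oplus> (b \<oplus> p) \<in> F"
      using 1 mv_filter_up[OF filter _ mv_le_impl_plus] by blast
    have "\<sim> \<sim> b \<oplus> \<sim> a \<in> F" using 1 by (simp add: mv_commute)
    then have "\<sim> (\<sim> b \<oplus> \<sim> p) \<oplus> (\<sim> a \<oplus> \<sim> p) \<in> F"
      using mv_filter_up[OF filter _ mv_le_impl_plus] by blast
    then have times: "\<sim> (a \<otimes> p) \<oplus> b \<otimes> p \<in> F" by (simp add: mv_times_def mv_commute)
    have "b \<oplus> p \<in> F" if "a \<oplus> p \<in> F" using plus that filter unfolding mv_filter_def by blast
    then show ?thesis using 1 plus times by (auto simp: step_def ple_def y z)
  next
    case 2
    \<comment> \<open>When only the smaller pair carries, the integer parts may become equal, and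
      this comparison of fractions decides.\<close>
    have "a \<otimes> p \<preceq> b \<oplus> p" by (meson mv_times_le mv_le_plus mv_le_trans)
    then have "\<sim> (a \<otimes> p) \<oplus> (b \<oplus> p) \<in> F" by (simp add: mv_le_def)
    then show ?thesis using 2 by (auto simp: step_def ple_def y z)
  qed
qed

lemma steps_mono: "y \<sqsubseteq> z \<Longrightarrow> (step p ^^ n) y \<sqsubseteq> (step p ^^ n) z"
  by (induction n) (simp_all add: step_mono)

section \<open>The real value as asymptotic rate of carries\<close>

definition count :: "'a \<Rightarrow> nat \<Rightarrow> nat" where
  "count p n = fst ((step p ^^ n) (0, \<zero>))"

text \<open>The start lies between two consecutive integers, so monotonicity sandwiches the result
  between two translates of the run from zero.\<close>

lemma steps_bounds:
  "fst z + count p n \<le> fst ((step p ^^ n) z)" "fst ((step p ^^ n) z) \<le> Suc (fst z + count p n)"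
proof -
  obtain k a where z: "z = (k, a)" by (cases z)
  have "(k + 0, \<zero>) \<sqsubseteq> (k, a)" "(k, a) \<sqsubseteq> (Suc k + 0, \<zero>)" by (simp_all add: ple_def)
  then have "(step p ^^ n) (k + 0, \<zero>) \<sqsubseteq> (step p ^^ n) (k, a)"
    "(step p ^^ n) (k, a) \<sqsubseteq> (step p ^^ n) (Suc k + 0, \<zero>)" by (auto intro: steps_mono)
  then show "fst z + count p n \<le> fst ((step p ^^ n) z)" "fst ((step p ^^ n) z) \<le> Suc (fst z + count p n)"
    unfolding steps_shift by (auto simp: ple_def count_def z)
qed

lemma count_le: "count p n \<le> n"
proof (induction n)
  case (Suc n)
  have "fst (step p z) \<le> Suc (fst z)" for z by (simp add: step_def)
  from this[of "(step p ^^ n) (0, \<zero>)"] show ?case using Suc unfolding count_def by simp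
qed (simp add: count_def)

lemma count_double: "2 * count p n \<le> count p (2 * n)"
  using steps_bounds(1)[of "(step p ^^ n) (0, \<zero>)" p n]
  by (simp add: count_def mult_2 funpow_add)

text \<open>Along powers of two the quotients increase by \<open>count_double\<close>, so bounded
  monotone convergence gives the limit.\<close>

definition val :: "'a \<Rightarrow> real" where
  "val p = lim (\<lambda>j. count p (2 ^ j) / 2 ^ j)"

lemma val_LIMSEQ: "(\<lambda>j. count p (2 ^ j) / 2 ^ j) \<longlonglongrightarrow> val p"
proof -
  have "incseq (\<lambda>j. real (count p (2 ^ j)) / 2 ^ j)"
  proof (rule incseq_SucI)
    fix j
    have "2 * real (count p (2 ^ j)) \<le> real (count p (2 ^ Suc j))"
      using of_nat_mono[OF count_double[of p "2 ^ j"], where 'a = real] by simp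
    then show "real (count p (2 ^ j)) / 2 ^ j \<le> real (count p (2 ^ Suc j)) / 2 ^ Suc j"
      by (simp add: field_simps)
  qed
  moreover have "real (count p (2 ^ j)) / 2 ^ j \<le> 1" for j
    using of_nat_mono[OF count_le[of p "2 ^ j"], where 'a = real] by (simp add: divide_le_eq)
  ultimately have "convergent (\<lambda>j. real (count p (2 ^ j)) / 2 ^ j)"
    by (intro Bseq_mono_convergent BseqI'[of _ 1]) (auto dest: incseqD)
  then show ?thesis unfolding val_def by (rule convergent_LIMSEQ_iff[THEN iffD1])
qed

lemma val_bounds: "0 \<le> val p" "val p \<le> 1"
proof -
  show "0 \<le> val p" by (rule LIMSEQ_le_const[OF val_LIMSEQ]) auto
  have "real (count p (2 ^ j)) / 2 ^ j \<le> 1" for j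
    using of_nat_mono[OF count_le[of p "2 ^ j"], where 'a = real] by (simp add: divide_le_eq)
  then show "val p \<le> 1" by (intro LIMSEQ_le_const2[OF val_LIMSEQ]) auto
qed

lemma count_in: assumes "p \<in> F" shows "count p n = n"
proof -
  have "snd z \<oplus> p \<in> F" for z :: "nat \<times> 'a"
    using assms mv_filter_up[OF filter] mv_le_plus by blast
  then have "fst ((step p ^^ n) (0, \<zero>)) = n" by (induction n) (simp_all add: step_def)
  then show ?thesis by (simp add: count_def)
qed

lemma val_in: "p \<in> F \<Longrightarrow> val p = 1"
  using val_LIMSEQ[of p] by (simp add: count_in LIMSEQ_const_iff)

lemma val_zero: "val \<zero> = 0"
proof -
  have "(step \<zero> ^^ n) (0, \<zero>) = (0, \<zero>)" for n by (induction n) (simp_all add: step_def)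
  then show ?thesis using val_LIMSEQ[of \<zero>] by (simp add: count_def LIMSEQ_const_iff)
qed

text \<open>An error of one carry disappears after division by \<open>2 ^ j\<close>.\<close>

lemma val_limit_eq:
  assumes "\<And>n. count a n + count b n \<le> f n" "\<And>n. f n \<le> Suc (count a n + count b n)"
    and lim: "(\<lambda>j. real (f (2 ^ j)) / 2 ^ j) \<longlonglongrightarrow> r"
  shows "r = val a + val b"
proof -
  have ab: "(\<lambda>j. count a (2 ^ j) / 2 ^ j + count b (2 ^ j) / 2 ^ j) \<longlonglongrightarrow> val a + val b"
    by (intro tendsto_add val_LIMSEQ)
  have "(\<lambda>j. (1 / 2 :: real) ^ j) \<longlonglongrightarrow> 0" by (rule LIMSEQ_realpow_zero) auto
  from tendsto_add[OF ab this] have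
    ub: "(\<lambda>j. count a (2 ^ j) / 2 ^ j + count b (2 ^ j) / 2 ^ j + (1 / 2) ^ j) \<longlonglongrightarrow> val a + val b"
    by simp
  have "(\<lambda>j. real (f (2 ^ j)) / 2 ^ j) \<longlonglongrightarrow> val a + val b"
  proof (rule tendsto_sandwich[OF _ _ ab ub]; rule always_eventually; rule allI)
    fix j
    have "real (count a (2 ^ j)) + count b (2 ^ j) \<le> f (2 ^ j)"
      using assms(1)[of "2 ^ j"] by linarith
    then show "count a (2 ^ j) / 2 ^ j + count b (2 ^ j) / 2 ^ j \<le> real (f (2 ^ j)) / 2 ^ j"
      by (simp add: divide_right_mono flip: add_divide_distrib)
    have "real (f (2 ^ j)) \<le> real (count a (2 ^ j)) + count b (2 ^ j) + 1"
      using assms(2)[of "2 ^ j"] by linarith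
    then show "real (f (2 ^ j)) / 2 ^ j \<le> count a (2 ^ j) / 2 ^ j + count b (2 ^ j) / 2 ^ j + (1 / 2) ^ j"
      by (simp add: divide_right_mono power_one_over flip: add_divide_distrib)
  qed
  then show ?thesis using lim LIMSEQ_unique by blast
qed

lemma val_add:
  assumes ab: "a \<otimes> b \<doteq> \<zero>"
  shows "val (a \<oplus> b) = val a + val b"
proof (rule val_limit_eq[OF _ _ val_LIMSEQ])
  fix n
  have "((\<lambda>z. step b (step a z)) ^^ n) (0, \<zero>) \<simeq> (step (a \<oplus> b) ^^ n) (0, \<zero>)"
  proof (induction n)
    case (Suc n)
    then have "step b (step a (((\<lambda>z. step b (step a z)) ^^ n) (0, \<zero>)))
        \<simeq> step b (step a ((step (a \<oplus> b) ^^ n) (0, \<zero>)))" by (intro step_cong)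
    also have "\<dots> \<simeq> step (a \<oplus> b) ((step (a \<oplus> b) ^^ n) (0, \<zero>))"
      using ab by (intro step_plus steps_proper) simp_all
    finally show ?case by simp
  qed simp
  then have "count (a \<oplus> b) n = fst ((step b ^^ n) ((step a ^^ n) (0, \<zero>)))"
    using steps_compose[where z = "(0, \<zero>)"] by (simp add: count_def peq_def)
  then show "count a n + count b n \<le> count (a \<oplus> b) n" "count (a \<oplus> b) n \<le> Suc (count a n + count b n)"
    using steps_bounds[where z = "(step a ^^ n) (0, \<zero>)"] by (simp_all add: count_def)
qed

lemma val_add_carry:
  assumes ab: "a \<oplus> b \<in> F"
  shows "1 + val (a \<otimes> b) = val a + val b"
proof (rule val_limit_eq)
  have "(\<lambda>j. 1 + count (a \<otimes> b) (2 ^ j) / 2 ^ j) \<longlonglongrightarrow> 1 + val (a \<otimes> b)"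
    by (intro tendsto_intros val_LIMSEQ)
  then show "(\<lambda>j. real ((\<lambda>n. n + count (a \<otimes> b) n) (2 ^ j)) / 2 ^ j) \<longlonglongrightarrow> 1 + val (a \<otimes> b)"
    by (simp add: add_divide_distrib)
next
  fix n
  \<comment> \<open>Each round yields one unit and the remainder \<open>a \<otimes> b\<close>; the
    units are collected in the start value \<open>n\<close>.\<close>
  have "((\<lambda>z. step b (step a z)) ^^ n) (0, \<zero>) \<simeq> (step (a \<otimes> b) ^^ n) (n, \<zero>)"
  proof (induction n)
    case (Suc n)
    let ?z = "(step (a \<otimes> b) ^^ n) (n, \<zero>)"
    have "step b (step a (((\<lambda>z. step b (step a z)) ^^ n) (0, \<zero>))) \<simeq> step b (step a ?z)"
      using Suc by (intro step_cong)
    also have "\<dots> \<simeq> step (a \<otimes> b) (Suc (fst ?z), snd ?z)"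
      using step_carry[OF ab, of "fst ?z" "snd ?z"] by simp
    also have "\<dots> = (step (a \<otimes> b) ^^ Suc n) (Suc n, \<zero>)"
      using steps_shift[of n "a \<otimes> b" 1 n \<zero>] by simp
    finally show ?case by simp
  qed simp
  then have "n + count (a \<otimes> b) n = fst ((step b ^^ n) ((step a ^^ n) (0, \<zero>)))"
    using steps_compose[where z = "(0, \<zero>)"] steps_shift[of n "a \<otimes> b" n 0 \<zero>]
    by (simp add: count_def peq_def)
  then show "count a n + count b n \<le> n + count (a \<otimes> b) n" "n + count (a \<otimes> b) n \<le> Suc (count a n + count b n)"
    using steps_bounds[where z = "(step a ^^ n) (0, \<zero>)"] by (simp_all add: count_def)
qed

text \<open>One of the two additivity laws always applies, and \<open>val_bounds\<close> accounts
  for the truncation. With \<open>val_neg\<close> and \<open>val_zero\<close> this makes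
  \<open>val\<close> a homomorphism into the unit interval.\<close>

lemma val_plus: "val (a \<oplus> b) = min 1 (val a + val b)"
proof (cases "a \<oplus> b \<in> F")
  case True
  then show ?thesis
    using val_in[OF True] val_add_carry[OF True] val_bounds[of "a \<otimes> b"] by simp
next
  case False
  then have "val (a \<oplus> b) = val a + val b" using plus_or_times val_add by blast
  then show ?thesis using val_bounds(2)[of "a \<oplus> b"] by simp
qed

lemma val_neg: "val (\<sim> a) = 1 - val a"
  using val_add_carry[of a "\<sim> a"] by (simp add: val_zero)

end

section \<open>Implicational calculus and the algebra of formula classes\<close>

section \<open>The Lindenbaum algebra\<close>

lemma luk_trans: "\<turnstile>\<^sub>L \<phi> \<^bold>\<rightarrow> \<psi> \<Longrightarrow> \<turnstile>\<^sub>L \<psi> \<^bold>\<rightarrow> \<gamma> \<Longrightarrow> \<turnstile>\<^sub>L \<phi> \<^bold>\<rightarrow> \<gamma>"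
  by (meson luk_ax luk_mp L2)

lemma luk_suffix: "\<turnstile>\<^sub>L \<phi> \<^bold>\<rightarrow> \<psi> \<Longrightarrow> \<turnstile>\<^sub>L (\<psi> \<^bold>\<rightarrow> \<gamma>) \<^bold>\<rightarrow> (\<phi> \<^bold>\<rightarrow> \<gamma>)"
  by (meson luk_ax luk_mp L2)

lemma luk_assertion: "\<turnstile>\<^sub>L \<phi> \<^bold>\<rightarrow> ((\<phi> \<^bold>\<rightarrow> \<psi>) \<^bold>\<rightarrow> \<psi>)"
  by (rule luk_trans[OF luk_ax[OF L1] luk_ax[OF L3]])

lemma luk_exchange: "\<turnstile>\<^sub>L (\<phi> \<^bold>\<rightarrow> (\<psi> \<^bold>\<rightarrow> \<gamma>)) \<^bold>\<rightarrow> (\<psi> \<^bold>\<rightarrow> (\<phi> \<^bold>\<rightarrow> \<gamma>))"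
  by (rule luk_trans[OF luk_ax[OF L2] luk_suffix[OF luk_assertion]])

lemma luk_refl: "\<turnstile>\<^sub>L \<phi> \<^bold>\<rightarrow> \<phi>"
proof -
  have "\<turnstile>\<^sub>L (\<phi> \<^bold>\<rightarrow> (\<phi> \<^bold>\<rightarrow> \<phi>)) \<^bold>\<rightarrow> (\<phi> \<^bold>\<rightarrow> \<phi>)"
    by (rule luk_mp[OF luk_ax[OF L1] luk_exchange])
  then show ?thesis by (rule luk_mp[OF luk_ax[OF L1]])
qed

lemma luk_neg_neg_elim: "\<turnstile>\<^sub>L \<^bold>\<not> \<^bold>\<not> \<phi> \<^bold>\<rightarrow> \<phi>"
proof -
  let ?\<theta> = "\<phi> \<^bold>\<rightarrow> \<phi>"
  have "\<turnstile>\<^sub>L \<^bold>\<not> \<^bold>\<not> \<phi> \<^bold>\<rightarrow> (\<^bold>\<not> \<^bold>\<not> ?\<theta> \<^bold>\<rightarrow> \<^bold>\<not> \<^bold>\<not> \<phi>)" by (rule luk_ax[OF L1])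
  then have "\<turnstile>\<^sub>L \<^bold>\<not> \<^bold>\<not> \<phi> \<^bold>\<rightarrow> (?\<theta> \<^bold>\<rightarrow> \<phi>)" by (meson luk_trans luk_ax L4)
  then show ?thesis by (rule luk_mp[OF luk_refl luk_mp[OF _ luk_exchange]])
qed

lemma luk_neg_neg_intro: "\<turnstile>\<^sub>L \<phi> \<^bold>\<rightarrow> \<^bold>\<not> \<^bold>\<not> \<phi>"
  by (rule luk_mp[OF luk_neg_neg_elim luk_ax[OF L4]])

lemma luk_contrapos: "\<turnstile>\<^sub>L \<phi> \<^bold>\<rightarrow> \<psi> \<Longrightarrow> \<turnstile>\<^sub>L \<^bold>\<not> \<psi> \<^bold>\<rightarrow> \<^bold>\<not> \<phi>"
  by (rule luk_mp[OF luk_trans[OF luk_neg_neg_elim luk_trans[OF _ luk_neg_neg_intro]] luk_ax[OF L4]])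

lemma luk_prefix: "\<turnstile>\<^sub>L \<psi> \<^bold>\<rightarrow> \<gamma> \<Longrightarrow> \<turnstile>\<^sub>L (\<phi> \<^bold>\<rightarrow> \<psi>) \<^bold>\<rightarrow> (\<phi> \<^bold>\<rightarrow> \<gamma>)"
  by (rule luk_mp[OF _ luk_mp[OF luk_ax[OF L2] luk_exchange]])

lemma luk_swap: "\<turnstile>\<^sub>L (\<^bold>\<not> \<phi> \<^bold>\<rightarrow> \<psi>) \<^bold>\<rightarrow> (\<^bold>\<not> \<psi> \<^bold>\<rightarrow> \<phi>)"
  by (rule luk_trans[OF luk_prefix[OF luk_neg_neg_intro] luk_ax[OF L4]])

definition luk_equiv :: "'a fm \<Rightarrow> 'a fm \<Rightarrow> bool" where
  "luk_equiv \<phi> \<psi> \<longleftrightarrow> (\<turnstile>\<^sub>L \<phi> \<^bold>\<rightarrow> \<psi>) \<and> (\<turnstile>\<^sub>L \<psi> \<^bold>\<rightarrow> \<phi>)"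

lemma luk_equiv_refl: "luk_equiv \<phi> \<phi>"
  by (simp add: luk_equiv_def luk_refl)

lemma luk_equiv_trans [trans]: "luk_equiv \<phi> \<psi> \<Longrightarrow> luk_equiv \<psi> \<gamma> \<Longrightarrow> luk_equiv \<phi> \<gamma>"
  unfolding luk_equiv_def by (blast intro: luk_trans)

lemma luk_equiv_sym: "luk_equiv \<phi> \<psi> \<Longrightarrow> luk_equiv \<psi> \<phi>"
  unfolding luk_equiv_def by blast

lemma luk_equiv_neg: "luk_equiv \<phi> \<psi> \<Longrightarrow> luk_equiv (\<^bold>\<not> \<phi>) (\<^bold>\<not> \<psi>)"
  unfolding luk_equiv_def by (blast intro: luk_contrapos)

lemma luk_equiv_Imp: "luk_equiv \<phi> \<phi>' \<Longrightarrow> luk_equiv \<psi> \<psi>' \<Longrightarrow> luk_equiv (\<phi> \<^bold>\<rightarrow> \<psi>) (\<phi>' \<^bold>\<rightarrow> \<psi>')"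
  unfolding luk_equiv_def by (blast intro: luk_trans luk_prefix luk_suffix)

lemma luk_equiv_Oplus_Imp: "luk_equiv (\<phi> \<^bold>\<oplus> \<psi>) (\<^bold>\<not> \<phi> \<^bold>\<rightarrow> \<psi>)"
  unfolding luk_equiv_def by (blast intro: luk_ax L_oplus1 L_oplus2)

lemma luk_equiv_Oplus:
  "luk_equiv \<phi> \<phi>' \<Longrightarrow> luk_equiv \<psi> \<psi>' \<Longrightarrow> luk_equiv (\<phi> \<^bold>\<oplus> \<psi>) (\<phi>' \<^bold>\<oplus> \<psi>')"
  by (meson luk_equiv_Oplus_Imp luk_equiv_Imp luk_equiv_neg luk_equiv_sym luk_equiv_trans)

lemma luk_equiv_Oplus_commute: "luk_equiv (\<phi> \<^bold>\<oplus> \<psi>) (\<psi> \<^bold>\<oplus> \<phi>)"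
proof -
  have "luk_equiv (\<^bold>\<not> \<phi> \<^bold>\<rightarrow> \<psi>) (\<^bold>\<not> \<psi> \<^bold>\<rightarrow> \<phi>)"
    unfolding luk_equiv_def by (blast intro: luk_swap)
  then show ?thesis
    by (meson luk_equiv_Oplus_Imp luk_equiv_sym luk_equiv_trans)
qed

lemma luk_equiv_Oplus_left_commute: "luk_equiv (\<phi> \<^bold>\<oplus> (\<psi> \<^bold>\<oplus> \<gamma>)) (\<psi> \<^bold>\<oplus> (\<phi> \<^bold>\<oplus> \<gamma>))"
proof -
  have *: "luk_equiv (\<phi> \<^bold>\<oplus> (\<psi> \<^bold>\<oplus> \<gamma>)) (\<^bold>\<not> \<phi> \<^bold>\<rightarrow> (\<^bold>\<not> \<psi> \<^bold>\<rightarrow> \<gamma>))" for \<phi> \<psi> \<gamma> :: "'a fm"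
    by (meson luk_equiv_Oplus_Imp luk_equiv_Imp luk_equiv_refl luk_equiv_trans)
  have "luk_equiv (\<^bold>\<not> \<phi> \<^bold>\<rightarrow> (\<^bold>\<not> \<psi> \<^bold>\<rightarrow> \<gamma>)) (\<^bold>\<not> \<psi> \<^bold>\<rightarrow> (\<^bold>\<not> \<phi> \<^bold>\<rightarrow> \<gamma>))"
    unfolding luk_equiv_def by (blast intro: luk_exchange)
  then show ?thesis by (meson * luk_equiv_sym luk_equiv_trans)
qed

lemma luk_equiv_Top: "\<turnstile>\<^sub>L \<phi> \<Longrightarrow> \<turnstile>\<^sub>L \<psi> \<Longrightarrow> luk_equiv \<phi> \<psi>"
  unfolding luk_equiv_def by (meson luk_ax luk_mp L1)

\<comment> \<open>Only Lukasiewicz-provable equivalence is divided out, for any type of atoms; on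
  modal formulas the FP theorems then appear as a filter of this one algebra.\<close>
quotient_type 'a lind = "'a fm" / luk_equiv
  by (rule equivpI) (auto intro!: reflpI sympI transpI intro: luk_equiv_refl luk_equiv_sym luk_equiv_trans)

instantiation lind :: (type) mv_algebra
begin

lift_definition mv_zero_lind :: "'a lind" is "\<^bold>\<bottom>" .
lift_definition mv_neg_lind :: "'a lind \<Rightarrow> 'a lind" is Neg by (rule luk_equiv_neg)
lift_definition mv_plus_lind :: "'a lind \<Rightarrow> 'a lind \<Rightarrow> 'a lind" is Oplus by (rule luk_equiv_Oplus)

instance
proof
  fix x y z :: "'a lind"
  show "(x \<oplus> y) \<oplus> z = x \<oplus> (y \<oplus> z)"
    by transfer (meson luk_equiv_Oplus luk_equiv_Oplus_commute luk_equiv_Oplus_left_commute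
        luk_equiv_refl luk_equiv_trans)
  show "x \<oplus> y = y \<oplus> x" by transfer (rule luk_equiv_Oplus_commute)
  show "x \<oplus> \<zero> = x"
  proof transfer
    fix \<phi> :: "'a fm"
    have "luk_equiv (\<phi> \<^bold>\<oplus> \<^bold>\<bottom>) (\<^bold>\<not> \<^bold>\<bottom> \<^bold>\<rightarrow> \<phi>)"
      by (meson luk_equiv_Oplus_commute luk_equiv_Oplus_Imp luk_equiv_trans)
    also have "luk_equiv (\<^bold>\<not> \<^bold>\<bottom> \<^bold>\<rightarrow> \<phi>) \<phi>"
      unfolding luk_equiv_def by (meson luk_assertion luk_ax luk_mp L1 L_bot)
    finally show "luk_equiv (\<phi> \<^bold>\<oplus> \<^bold>\<bottom>) \<phi>" .
  qed
  show "\<sim> \<sim> x = x"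
    by transfer (simp add: luk_equiv_def luk_neg_neg_elim luk_neg_neg_intro)
  show "x \<oplus> \<sim> \<zero> = \<sim> \<zero>"
    by transfer (meson luk_equiv_Top luk_ax luk_mp L1 L_bot L_oplus2)
  show "\<sim> (\<sim> x \<oplus> y) \<oplus> y = \<sim> (\<sim> y \<oplus> x) \<oplus> x"
    by transfer (fold Imp_def, simp add: luk_equiv_def luk_ax L3)
qed

end

lift_definition cls :: "'a fm \<Rightarrow> 'a lind" is "\<lambda>\<phi>. \<phi>" .

lemma cls_simps [simp]:
  "cls \<^bold>\<bottom> = \<zero>" "cls (\<^bold>\<not> \<phi>) = \<sim> cls \<phi>" "cls (\<phi> \<^bold>\<oplus> \<psi>) = cls \<phi> \<oplus> cls \<psi>"
  by (transfer, rule luk_equiv_refl)+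

lemma cls_derived [simp]:
  "cls \<^bold>\<top> = \<one>" "cls (\<phi> \<^bold>\<rightarrow> \<psi>) = \<sim> cls \<phi> \<oplus> cls \<psi>" "cls (\<phi> \<^bold>\<odot> \<psi>) = cls \<phi> \<otimes> cls \<psi>"
  "cls (\<phi> \<^bold>\<or> \<psi>) = cls \<phi> \<squnion> cls \<psi>"
  "cls (\<phi> \<^bold>\<and> \<psi>) = \<sim> (\<sim> cls \<phi> \<squnion> \<sim> cls \<psi>)"
  by (simp_all add: Top_def Imp_def Odot_def Disj_def Conj_def mv_times_def mv_sup_def)

lemma luk_thm_iff_cls: "\<turnstile>\<^sub>L \<phi> \<longleftrightarrow> cls \<phi> = \<one>"
proof -
  have "cls \<phi> = cls \<^bold>\<top> \<longleftrightarrow> \<turnstile>\<^sub>L \<phi>"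
  proof (transfer, rule iffI)
    fix \<phi> :: "'a fm"
    have top: "\<turnstile>\<^sub>L (\<^bold>\<top> :: 'a fm)" unfolding Top_def by (rule luk_ax[OF L_bot])
    show "\<turnstile>\<^sub>L \<phi> \<Longrightarrow> luk_equiv \<phi> \<^bold>\<top>" using top by (rule luk_equiv_Top[rotated])
    show "luk_equiv \<phi> \<^bold>\<top> \<Longrightarrow> \<turnstile>\<^sub>L \<phi>" using top luk_mp unfolding luk_equiv_def by blast
  qed
  then show ?thesis by simp
qed

lemma cls_surj: obtains \<phi> where "x = cls \<phi>"
  by transfer (blast intro: luk_equiv_refl)

lemma (in mv_algebra) mv_inf_filter_iff:
  assumes F: "mv_filter F" shows "\<sim> (\<sim> x \<squnion> \<sim> y) \<in> F \<longleftrightarrow> x \<in> F \<and> y \<in> F"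
proof
  have "\<sim> (\<sim> x \<squnion> \<sim> y) \<preceq> \<sim> \<sim> x" "\<sim> (\<sim> x \<squnion> \<sim> y) \<preceq> \<sim> \<sim> y"
    unfolding mv_neg_le by (rule mv_le_sup)+
  then show "\<sim> (\<sim> x \<squnion> \<sim> y) \<in> F \<Longrightarrow> x \<in> F \<and> y \<in> F"
    using mv_filter_up[OF F] by auto
  have "x \<otimes> y \<preceq> \<sim> (\<sim> x \<squnion> \<sim> y)"
    unfolding mv_times_def mv_neg_le by (intro mv_sup_least mv_le_plus)
  then show "x \<in> F \<and> y \<in> F \<Longrightarrow> \<sim> (\<sim> x \<squnion> \<sim> y) \<in> F"
    using mv_filter_up[OF F] mv_filter_times[OF F] by blast
qed

lemma subst_derived [simp]:
  "subst \<sigma> \<^bold>\<top> = \<^bold>\<top>" "subst \<sigma> (\<phi> \<^bold>\<rightarrow> \<psi>) = subst \<sigma> \<phi> \<^bold>\<rightarrow> subst \<sigma> \<psi>"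
  "subst \<sigma> (\<phi> \<^bold>\<odot> \<psi>) = subst \<sigma> \<phi> \<^bold>\<odot> subst \<sigma> \<psi>" "subst \<sigma> (\<phi> \<^bold>\<or> \<psi>) = subst \<sigma> \<phi> \<^bold>\<or> subst \<sigma> \<psi>"
  "subst \<sigma> (\<phi> \<^bold>\<and> \<psi>) = subst \<sigma> \<phi> \<^bold>\<and> subst \<sigma> \<psi>"
  "subst \<sigma> (\<phi> \<^bold>\<leftrightarrow> \<psi>) = subst \<sigma> \<phi> \<^bold>\<leftrightarrow> subst \<sigma> \<psi>"
  by (simp_all add: Top_def Imp_def Odot_def Disj_def Conj_def Iff_def)

lemma atoms_derived [simp]:
  "atoms \<^bold>\<top> = {}" "atoms (\<phi> \<^bold>\<rightarrow> \<psi>) = atoms \<phi> \<union> atoms \<psi>"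
  "atoms (\<phi> \<^bold>\<odot> \<psi>) = atoms \<phi> \<union> atoms \<psi>" "atoms (\<phi> \<^bold>\<or> \<psi>) = atoms \<phi> \<union> atoms \<psi>"
  "atoms (\<phi> \<^bold>\<and> \<psi>) = atoms \<phi> \<union> atoms \<psi>" "atoms (\<phi> \<^bold>\<leftrightarrow> \<psi>) = atoms \<phi> \<union> atoms \<psi>"
  by (auto simp: Top_def Imp_def Odot_def Disj_def Conj_def Iff_def)

lemma subst_subst: "subst \<delta> (subst \<sigma> \<phi>) = subst (\<lambda>a. subst \<delta> (\<sigma> a)) \<phi>"
  by (induction \<phi>) simp_all

lemma subst_id: "(\<And>a. a \<in> atoms \<phi> \<Longrightarrow> \<sigma> a = Atom a) \<Longrightarrow> subst \<sigma> \<phi> = \<phi>"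
  by (induction \<phi>) simp_all

lemma luk_axiom_subst: "luk_axiom \<phi> \<Longrightarrow> luk_axiom (subst \<sigma> \<phi>)"
  by (induction rule: luk_axiom.induct) (simp_all add: luk_axiom.intros)

lemma luk_thm_subst: "\<turnstile>\<^sub>L \<phi> \<Longrightarrow> \<turnstile>\<^sub>L subst \<sigma> \<phi>"
  by (induction rule: luk_thm.induct) (auto intro: luk_ax luk_mp luk_axiom_subst)


section \<open>FP theorems as a filter, and their substitution properties\<close>

section \<open>Derivability in FP\<close>

lemma fp_of_luk: "\<turnstile>\<^sub>L \<Phi> \<Longrightarrow> \<turnstile>\<^sub>F\<^sub>P \<Phi>"
  by (induction rule: luk_thm.induct) (auto intro: fp_luk fp_mp)

definition fp_filter :: "event lind set" where
  "fp_filter = {cls \<Phi> | \<Phi>. \<turnstile>\<^sub>F\<^sub>P \<Phi>}"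

lemma cls_in_fp_filter [simp]: "cls \<Phi> \<in> fp_filter \<longleftrightarrow> \<turnstile>\<^sub>F\<^sub>P \<Phi>"
proof
  assume "cls \<Phi> \<in> fp_filter"
  then obtain \<Psi> where "cls \<Phi> = cls \<Psi>" and \<Psi>: "\<turnstile>\<^sub>F\<^sub>P \<Psi>" by (auto simp: fp_filter_def)
  then have "\<turnstile>\<^sub>L \<Psi> \<^bold>\<rightarrow> \<Phi>" by (simp add: luk_thm_iff_cls)
  then show "\<turnstile>\<^sub>F\<^sub>P \<Phi>" using \<Psi> fp_mp fp_of_luk by blast
qed (auto simp: fp_filter_def)

interpretation fp: mv_filter_locale fp_filter
proof
  show "mv_filter fp_filter"
    unfolding mv_filter_def
  proof (intro conjI allI impI)
    have "\<turnstile>\<^sub>F\<^sub>P \<^bold>\<top>" by (intro fp_of_luk) (simp add: luk_thm_iff_cls)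
    then show "\<one> \<in> fp_filter" using cls_in_fp_filter[of "\<^bold>\<top>"] by simp
    fix x y assume xy: "x \<in> fp_filter" "\<sim> x \<oplus> y \<in> fp_filter"
    obtain \<Phi> \<Psi> where "x = cls \<Phi>" "y = cls \<Psi>" using cls_surj by metis
    then show "y \<in> fp_filter"
      using xy fp_mp[of \<Phi> \<Psi>] cls_in_fp_filter[of "\<Phi> \<^bold>\<rightarrow> \<Psi>"] by simp
  qed
qed

lemma fp_iff: "\<turnstile>\<^sub>F\<^sub>P \<Phi> \<^bold>\<leftrightarrow> \<Psi> \<longleftrightarrow> mv_cong fp_filter (cls \<Phi>) (cls \<Psi>)"
proof -
  have "\<turnstile>\<^sub>F\<^sub>P \<Phi> \<^bold>\<leftrightarrow> \<Psi> \<longleftrightarrow> cls (\<Phi> \<^bold>\<leftrightarrow> \<Psi>) \<in> fp_filter" by simp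
  also have "\<dots> \<longleftrightarrow> mv_cong fp_filter (cls \<Phi>) (cls \<Psi>)"
    unfolding Iff_def cls_derived(5) mv_inf_filter_iff[OF fp.filter] by (simp add: mv_cong_def del: cls_in_fp_filter)
  finally show ?thesis .
qed

lemma fp_iff_refl: "\<turnstile>\<^sub>F\<^sub>P \<Phi> \<^bold>\<leftrightarrow> \<Phi>"
  by (simp add: fp_iff)

lemma fp_iff_Top: "\<turnstile>\<^sub>F\<^sub>P \<Phi> \<^bold>\<leftrightarrow> \<^bold>\<top> \<longleftrightarrow> \<turnstile>\<^sub>F\<^sub>P \<Phi>"
  by (simp add: fp_iff fp.cong_one)

lemma fp_subst_cong:
  "(\<And>a. a \<in> atoms \<Phi> \<Longrightarrow> \<turnstile>\<^sub>F\<^sub>P \<sigma> a \<^bold>\<leftrightarrow> \<tau> a) \<Longrightarrow> \<turnstile>\<^sub>F\<^sub>P subst \<sigma> \<Phi> \<^bold>\<leftrightarrow> subst \<tau> \<Phi>"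
  by (induction \<Phi>) (simp_all add: fp_iff fp.cong_neg fp.cong_plus)

text \<open>The left-hand side is the additivity axiom with \<open>Pr\<close> erased:
  \<open>\<sim> (\<sim> x \<oplus> x \<otimes> y)\<close> is the infimum of \<open>x\<close> and
  \<open>\<sim> y\<close>, and adding \<open>y\<close> to it restores the full sum.\<close>

lemma mv_fp_oplus: "\<sim> (\<sim> x \<oplus> x \<otimes> y) \<oplus> y = x \<oplus> (y :: 'a :: mv_algebra)"
proof -
  have "\<sim> (\<sim> x \<oplus> x \<otimes> y) = \<sim> y \<otimes> (\<sim> \<sim> y \<oplus> x)"
    using mv_inf_commute[of x "\<sim> y"] by (simp add: mv_neg_plus mv_neg_times)
  then have "\<sim> (\<sim> x \<oplus> x \<otimes> y) \<oplus> y = (x \<oplus> y) \<otimes> \<sim> y \<oplus> y"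
    by (simp add: mv_commute mv_times_commute)
  also have "\<dots> = x \<oplus> y" by (intro mv_plus_times_neg mv_le_plus)
  finally show ?thesis .
qed

text \<open>Reading \<open>Pr \<phi>\<close> as \<open>\<phi>\<close> itself, that is, restricting to valuations among the states, is sound.\<close>

lemma fp_flatten: "\<turnstile>\<^sub>F\<^sub>P \<Phi> \<Longrightarrow> \<turnstile>\<^sub>L subst (\<lambda>\<phi>. \<phi>) \<Phi>"
proof (induction rule: fp_thm.induct)
  case (fp_luk \<Phi>)
  then show ?case by (intro luk_ax luk_axiom_subst)
next
  case (fp_mp \<Phi> \<Psi>)
  show ?case using fp_mp.IH unfolding subst_derived by (rule luk_mp)
qed (simp_all add: luk_thm_iff_cls mv_fp_oplus Iff_def)

text \<open>All FP schemes are closed under substitution in events. This provides the pullbacks of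
  states and the factor that undoes a rotation.\<close>

lemma fp_event_subst: "\<turnstile>\<^sub>F\<^sub>P \<Phi> \<Longrightarrow> \<turnstile>\<^sub>F\<^sub>P subst (\<lambda>\<phi>. Pr (subst e \<phi>)) \<Phi>"
proof (induction rule: fp_thm.induct)
  case (fp_luk \<Phi>)
  then show ?case by (intro fp_thm.fp_luk luk_axiom_subst)
next
  case (fp_mp \<Phi> \<Psi>)
  show ?case using fp_mp.IH unfolding subst_derived by (rule fp_thm.fp_mp)
qed (simp_all add: fp_neg fp_imp fp_oplus fp_nec luk_thm_subst)

lemma fp_Bot: "\<turnstile>\<^sub>F\<^sub>P Pr \<^bold>\<bottom> \<^bold>\<leftrightarrow> \<^bold>\<bottom>"
proof -
  have "\<turnstile>\<^sub>F\<^sub>P Pr (\<^bold>\<not> \<^bold>\<bottom>)" by (intro fp_nec luk_ax L_bot)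
  then have "\<sim> cls (Pr \<^bold>\<bottom>) \<in> fp_filter"
    using fp_neg[of "\<^bold>\<bottom>"] fp.cong_mem by (simp add: fp_iff)
  then show ?thesis by (simp add: fp_iff fp.cong_zero)
qed

text \<open>Flattening makes an FP theorem over variables a Lukasiewicz theorem, and those are
  stable under every substitution.\<close>

lemma prob_subst_variables: "prob_subst (range Atom) \<sigma>"
  unfolding prob_subst_def
proof (intro allI impI)
  have fp: "\<turnstile>\<^sub>F\<^sub>P subst \<sigma> \<Phi>" if "\<turnstile>\<^sub>F\<^sub>P \<Phi>" "atoms \<Phi> \<subseteq> range Atom" for \<Phi>
  proof -
    have "subst (\<lambda>i. \<sigma> (Atom i)) (subst (\<lambda>\<phi>. \<phi>) \<Phi>) = subst \<sigma> \<Phi>"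
      using that(2) by (induction \<Phi>) auto
    then show ?thesis using fp_of_luk[OF luk_thm_subst[OF fp_flatten[OF that(1)]]] by metis
  qed
  fix \<Phi> \<Psi> :: mfm
  assume "atoms \<Phi> \<subseteq> range Atom" "atoms \<Psi> \<subseteq> range Atom" "\<turnstile>\<^sub>F\<^sub>P \<Phi> \<^bold>\<leftrightarrow> \<Psi>"
  then show "\<turnstile>\<^sub>F\<^sub>P subst \<sigma> \<Phi> \<^bold>\<leftrightarrow> subst \<sigma> \<Psi>" using fp[of "\<Phi> \<^bold>\<leftrightarrow> \<Psi>"] by simp
qed


section \<open>Symbolic rotation of the boundary\<close>

section \<open>Rotating the boundary of the square\<close>

context mv_algebra
begin

definition mv_bd :: "'a \<Rightarrow> 'a \<Rightarrow> 'a" where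
  "mv_bd x y = (x \<squnion> \<sim> x) \<squnion> (y \<squnion> \<sim> y)"

text \<open>
  On the boundary, \<open>mv_rot x y q\<close> and \<open>mv_rot y (\<sim> x) q\<close> are the coordinates of the point
  \<open>(x, y)\<close> moved counterclockwise along the perimeter by \<open>q\<close>.
\<close>

definition mv_rot :: "'a \<Rightarrow> 'a \<Rightarrow> 'a \<Rightarrow> 'a" where
  "mv_rot x y q = (x \<oplus> q \<otimes> \<sim> y) \<otimes> \<sim> (q \<otimes> y) \<squnion> q \<otimes> \<sim> y"

lemma mv_rot_simps:
  "mv_rot x y \<zero> = x" "mv_rot x \<zero> q = x \<oplus> q" "mv_rot x \<one> q = x \<otimes> \<sim> q"
  "mv_rot \<zero> y q = q \<otimes> \<sim> y" "mv_rot \<one> y q = \<sim> (q \<otimes> y)"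
proof -
  have "q \<otimes> \<sim> y \<preceq> \<sim> (q \<otimes> y)"
    using mv_le_trans[OF mv_times_le(2) mv_le_plus(2)] by (simp add: mv_neg_times)
  then show "mv_rot \<one> y q = \<sim> (q \<otimes> y)" by (simp add: mv_rot_def mv_sup_absorb)
qed (simp_all add: mv_rot_def mv_sup_absorb mv_le_plus mv_times_le)

lemma mv_bdI:
  "x \<squnion> y = \<one> \<Longrightarrow> mv_bd x y = \<one>" "x \<squnion> \<sim> y = \<one> \<Longrightarrow> mv_bd x y = \<one>"
  "\<sim> x \<squnion> y = \<one> \<Longrightarrow> mv_bd x y = \<one>" "\<sim> x \<squnion> \<sim> y = \<one> \<Longrightarrow> mv_bd x y = \<one>"
proof -
  have "x \<preceq> mv_bd x y" "\<sim> x \<preceq> mv_bd x y" "y \<preceq> mv_bd x y" "\<sim> y \<preceq> mv_bd x y"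
    unfolding mv_bd_def by (meson mv_le_sup mv_le_trans)+
  then show "x \<squnion> y = \<one> \<Longrightarrow> mv_bd x y = \<one>" "x \<squnion> \<sim> y = \<one> \<Longrightarrow> mv_bd x y = \<one>"
    "\<sim> x \<squnion> y = \<one> \<Longrightarrow> mv_bd x y = \<one>" "\<sim> x \<squnion> \<sim> y = \<one> \<Longrightarrow> mv_bd x y = \<one>"
    by (metis mv_one_le mv_sup_least)+
qed

text \<open>On each side the rotated coordinates become truncated sums and differences, for which
  prelinearity gives two of the four disjuncts of the boundary condition.\<close>

lemma mv_bd_rot_edge:
  assumes "x = \<zero> \<or> x = \<one> \<or> y = \<zero> \<or> y = \<one>"
  shows "mv_bd (mv_rot x y q) (mv_rot y (\<sim> x) q) = \<one>"
proof -
  consider "x = \<zero>" | "x = \<one>" | "y = \<zero>" | "y = \<one>" using assms by blast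
  then show ?thesis
  proof cases
    case 1
    have "mv_bd (q \<otimes> \<sim> y) (y \<otimes> \<sim> q) = \<one>"
      by (rule mv_bdI(4)) (simp add: mv_neg_times mv_prelinear)
    then show ?thesis using 1 by (simp add: mv_rot_simps)
  next
    case 2
    have "mv_bd (\<sim> (q \<otimes> y)) (y \<oplus> q) = \<one>"
      using mv_plus_or_times[of y q] by (intro mv_bdI(1)) (simp only: mv_sup_commute mv_times_commute)
    then show ?thesis using 2 by (simp add: mv_rot_simps)
  next
    case 3
    have "mv_bd (x \<oplus> q) (q \<otimes> x) = \<one>"
      using mv_plus_or_times[of x q] by (intro mv_bdI(2)) (simp only: mv_times_commute)
    then show ?thesis using 3 by (simp add: mv_rot_simps)
  next
    case 4
    have "\<sim> (q \<otimes> \<sim> x) = x \<oplus> \<sim> q" by (simp add: mv_neg_times mv_commute)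
    then have "mv_bd (x \<otimes> \<sim> q) (\<sim> (q \<otimes> \<sim> x)) = \<one>"
      using mv_plus_or_times[of x "\<sim> q"] by (intro mv_bdI(3)) (simp only: mv_sup_commute)
    then show ?thesis using 4 by (simp add: mv_rot_simps)
  qed
qed

end

text \<open>The hypothesis is a disjunction of four sides that \<open>F\<close> need not decide. A
  prime filter missing the conclusion decides it and makes the point congruent to an exact edge
  point.\<close>

lemma mv_bd_rot:
  assumes F: "mv_filter (F :: 'a :: mv_algebra set)" and bd: "mv_bd x y \<in> F"
  shows "mv_bd (mv_rot x y q) (mv_rot y (\<sim> x) q) \<in> F"
proof (rule ccontr)
  assume "mv_bd (mv_rot x y q) (mv_rot y (\<sim> x) q) \<notin> F"
  then obtain G where G: "mv_prime G" "F \<subseteq> G" and notin: "mv_bd (mv_rot x y q) (mv_rot y (\<sim> x) q) \<notin> G"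
    by (rule mv_prime_exists[OF F])
  interpret mv_prime_locale G by unfold_locales (rule G)
  have cong: "mv_cong G (mv_bd (mv_rot x y q) (mv_rot y (\<sim> x) q)) (mv_bd (mv_rot x' y' q) (mv_rot y' (\<sim> x') q))"
    if "mv_cong G x x'" "mv_cong G y y'" for x' y'
    unfolding mv_bd_def mv_rot_def using that by (intro cong_sup cong_neg cong_plus cong_times cong_refl)
  have "mv_bd x y \<in> G" using bd G by blast
  then consider "\<sim> x \<in> G" | "x \<in> G" | "\<sim> y \<in> G" | "y \<in> G" unfolding mv_bd_def using primeD by blast
  then obtain x' y' where "mv_cong G x x'" "mv_cong G y y'" "x' = \<zero> \<or> x' = \<one> \<or> y' = \<zero> \<or> y' = \<one>"
    using cong_one cong_zero cong_refl by metis
  then show False using cong[of x' y'] mv_bd_rot_edge[of x' y' q] notin cong_mem by fastforce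
qed

section \<open>States as models of FP, and their convexity\<close>

section \<open>States\<close>

primrec eval :: "('a \<Rightarrow> real) \<Rightarrow> 'a fm \<Rightarrow> real" where
  "eval v (Atom a) = v a"
| "eval v \<^bold>\<bottom> = 0"
| "eval v (\<^bold>\<not> \<phi>) = 1 - eval v \<phi>"
| "eval v (\<phi> \<^bold>\<oplus> \<psi>) = min 1 (eval v \<phi> + eval v \<psi>)"

lemma eval_derived:
  "eval v \<^bold>\<top> = 1"
  "eval v (\<phi> \<^bold>\<rightarrow> \<psi>) = min 1 (1 - eval v \<phi> + eval v \<psi>)"
  "eval v (\<phi> \<^bold>\<odot> \<psi>) = max 0 (eval v \<phi> + eval v \<psi> - 1)"
  by (simp_all add: Top_def Imp_def Odot_def)

lemma eval_subst: "eval v (subst \<sigma> \<phi>) = eval (\<lambda>a. eval v (\<sigma> a)) \<phi>"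
  by (induction \<phi>) simp_all

lemma eval_cong: "(\<And>a. a \<in> atoms \<phi> \<Longrightarrow> v a = w a) \<Longrightarrow> eval v \<phi> = eval w \<phi>"
  by (induction \<phi>) simp_all

definition unit_valued :: "('a \<Rightarrow> real) \<Rightarrow> bool" where
  "unit_valued v \<longleftrightarrow> (\<forall>a. 0 \<le> v a \<and> v a \<le> 1)"

lemma eval_range: assumes "unit_valued v" shows "0 \<le> eval v \<phi>" "eval v \<phi> \<le> 1"
proof -
  have "0 \<le> eval v \<phi> \<and> eval v \<phi> \<le> 1"
    using assms by (induction \<phi>) (simp_all add: unit_valued_def)
  then show "0 \<le> eval v \<phi>" "eval v \<phi> \<le> 1" by simp_all
qed

lemma eval_Disj: assumes "unit_valued v" shows "eval v (\<phi> \<^bold>\<or> \<psi>) = max (eval v \<phi>) (eval v \<psi>)"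
  using eval_range[OF assms, of \<phi>] eval_range[OF assms, of \<psi>] by (simp add: Disj_def eval_derived)

lemma eval_Conj: assumes "unit_valued v" shows "eval v (\<phi> \<^bold>\<and> \<psi>) = min (eval v \<phi>) (eval v \<psi>)"
  using eval_range[OF assms, of \<phi>] eval_range[OF assms, of \<psi>]
  by (simp add: Conj_def eval_Disj[OF assms])

lemma eval_Iff: assumes "unit_valued v" shows "eval v (\<phi> \<^bold>\<leftrightarrow> \<psi>) = 1 \<longleftrightarrow> eval v \<phi> = eval v \<psi>"
  by (auto simp add: Iff_def eval_Conj[OF assms] eval_derived min_def)

lemma eval_mp:
  assumes "unit_valued v" "eval v \<phi> = 1" "eval v (\<phi> \<^bold>\<rightarrow> \<psi>) = 1" shows "eval v \<psi> = 1"
  using assms eval_range[OF assms(1), of \<psi>] by (simp add: eval_derived min_def split: if_splits)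

lemma luk_axiom_sound: assumes v: "unit_valued v" and "luk_axiom \<phi>" shows "eval v \<phi> = 1"
  using assms(2)
proof cases
  case (L1 \<phi> \<psi>)
  then show ?thesis using eval_range[OF v, of \<phi>] eval_range[OF v, of \<psi>] by (simp add: eval_derived)
next
  case (L2 \<phi> \<psi> \<gamma>)
  then show ?thesis
    using eval_range[OF v, of \<phi>] eval_range[OF v, of \<psi>] eval_range[OF v, of \<gamma>]
    by (simp add: eval_derived)
next
  case (L3 \<phi> \<psi>)
  then show ?thesis using eval_range[OF v, of \<phi>] eval_range[OF v, of \<psi>] by (simp add: eval_derived)
next
  case (L4 \<phi> \<psi>)
  then show ?thesis by (simp add: eval_derived)
qed (simp_all add: eval_derived)

lemma luk_thm_sound: assumes "\<turnstile>\<^sub>L \<phi>" "unit_valued v" shows "eval v \<phi> = 1"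
  using assms by (induction rule: luk_thm.induct) (blast intro: luk_axiom_sound eval_mp)+

lemma luk_Odot_left: "\<turnstile>\<^sub>L \<phi> \<^bold>\<odot> \<psi> \<^bold>\<rightarrow> \<phi>"
  using mv_times_le(1)[of "cls \<phi>" "cls \<psi>"] unfolding mv_le_def luk_thm_iff_cls by simp

definition fp_state :: "(event \<Rightarrow> real) \<Rightarrow> bool" where
  "fp_state s \<longleftrightarrow> unit_valued s \<and> (\<forall>\<Phi>. (\<turnstile>\<^sub>F\<^sub>P \<Phi>) \<longrightarrow> eval s \<Phi> = 1)"

text \<open>
  The truncated additivity expressed by the axioms forces genuine additivity, so that states form
  a convex set.
\<close>

definition additive_state :: "(event \<Rightarrow> real) \<Rightarrow> bool" where
  "additive_state s \<longleftrightarrow> (\<forall>\<phi>. 0 \<le> s \<phi> \<and> s \<phi> \<le> 1) \<and> (\<forall>\<phi>. (\<turnstile>\<^sub>L \<phi>) \<longrightarrow> s \<phi> = 1)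
     \<and> (\<forall>\<phi>. s (\<^bold>\<not> \<phi>) = 1 - s \<phi>)
     \<and> (\<forall>\<phi> \<psi>. s (\<phi> \<^bold>\<rightarrow> \<psi>) \<le> 1 - s \<phi> + s \<psi>)
     \<and> (\<forall>\<phi> \<psi>. s (\<phi> \<^bold>\<oplus> \<psi>) + s (\<phi> \<^bold>\<odot> \<psi>) = s \<phi> + s \<psi>)"

lemma fp_state_additive: assumes s: "fp_state s" shows "additive_state s"
proof -
  have unit: "unit_valued s" and sound: "\<And>\<Phi>. (\<turnstile>\<^sub>F\<^sub>P \<Phi>) \<Longrightarrow> eval s \<Phi> = 1"
    using s by (auto simp: fp_state_def)
  have range: "0 \<le> s \<phi>" "s \<phi> \<le> 1" for \<phi> using unit by (auto simp: unit_valued_def)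
  have luk: "s \<phi> = 1" if "\<turnstile>\<^sub>L \<phi>" for \<phi> using sound[OF fp_nec[OF that]] by simp
  have neg: "s (\<^bold>\<not> \<phi>) = 1 - s \<phi>" for \<phi> using sound[OF fp_neg[of \<phi>]] by (simp add: eval_Iff[OF unit])
  have imp: "s (\<phi> \<^bold>\<rightarrow> \<psi>) \<le> 1 - s \<phi> + s \<psi>" for \<phi> \<psi>
    using sound[OF fp_imp[of \<phi> \<psi>]] range[of "\<phi> \<^bold>\<rightarrow> \<psi>"] by (auto simp: eval_derived min_def split: if_splits)
  have mono: "s \<phi> \<le> s \<psi>" if "\<turnstile>\<^sub>L \<phi> \<^bold>\<rightarrow> \<psi>" for \<phi> \<psi> using imp[of \<phi> \<psi>] luk[OF that] by simp
  have oplus: "s (\<phi> \<^bold>\<oplus> \<psi>) = min 1 (s \<phi> - s (\<phi> \<^bold>\<odot> \<psi>) + s \<psi>)" for \<phi> \<psi>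
  proof -
    have "s (\<phi> \<^bold>\<odot> \<psi>) \<le> s \<phi>"
      by (rule mono) (rule luk_Odot_left)
    moreover have "s (\<phi> \<^bold>\<oplus> \<psi>) = eval s ((Pr \<phi> \<^bold>\<rightarrow> Pr (\<phi> \<^bold>\<odot> \<psi>)) \<^bold>\<rightarrow> Pr \<psi>)"
      using sound[OF fp_oplus[of \<phi> \<psi>]] unfolding eval_Iff[OF unit] by simp
    ultimately show ?thesis by (simp add: eval_derived)
  qed
  have "s (\<phi> \<^bold>\<oplus> \<psi>) + s (\<phi> \<^bold>\<odot> \<psi>) = s \<phi> + s \<psi>" for \<phi> \<psi>
  proof -
    have "s (\<^bold>\<not> \<^bold>\<not> \<phi> \<^bold>\<oplus> \<^bold>\<not> \<^bold>\<not> \<psi>) = s (\<phi> \<^bold>\<oplus> \<psi>)"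
      by (rule antisym; rule mono) (simp_all add: luk_thm_iff_cls)
    \<comment> \<open>The axiom at the negated events truncates from below where the axiom at
      \<open>\<phi>\<close> and \<open>\<psi>\<close> truncates from above; together they leave the
      exact sum.\<close>
    then have "1 - s (\<phi> \<^bold>\<odot> \<psi>) = min 1 (1 - s \<phi> - (1 - s (\<phi> \<^bold>\<oplus> \<psi>)) + (1 - s \<psi>))"
      using oplus[of "\<^bold>\<not> \<phi>" "\<^bold>\<not> \<psi>"] by (simp add: Odot_def neg)
    then show ?thesis using oplus[of \<phi> \<psi>] range[of \<phi>] range[of \<psi>] by linarith
  qed
  then show ?thesis using range luk neg imp by (simp add: additive_state_def)
qed

lemma additive_state_fp: assumes s: "additive_state s" shows "fp_state s"
proof -
  have unit: "unit_valued s" and luk: "\<And>\<phi>. (\<turnstile>\<^sub>L \<phi>) \<Longrightarrow> s \<phi> = 1"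
    and neg: "\<And>\<phi>. s (\<^bold>\<not> \<phi>) = 1 - s \<phi>"
    and imp: "\<And>\<phi> \<psi>. s (\<phi> \<^bold>\<rightarrow> \<psi>) \<le> 1 - s \<phi> + s \<psi>"
    and add: "\<And>\<phi> \<psi>. s (\<phi> \<^bold>\<oplus> \<psi>) + s (\<phi> \<^bold>\<odot> \<psi>) = s \<phi> + s \<psi>"
    using s by (simp_all add: additive_state_def unit_valued_def)
  have "eval s \<Phi> = 1" if "\<turnstile>\<^sub>F\<^sub>P \<Phi>" for \<Phi>
    using that
  proof (induction rule: fp_thm.induct)
    case (fp_luk \<Phi>)
    then show ?case by (rule luk_axiom_sound[OF unit])
  next
    case (fp_imp \<phi> \<psi>)
    show ?case using imp[of \<phi> \<psi>] unit by (simp add: eval_derived unit_valued_def)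
  next
    case (fp_oplus \<phi> \<psi>)
    have "s (\<phi> \<^bold>\<odot> \<psi>) \<le> s \<phi>"
      using imp[of "\<phi> \<^bold>\<odot> \<psi>" \<phi>] luk[OF luk_Odot_left[of \<phi> \<psi>]] by simp
    moreover have "s (\<phi> \<^bold>\<oplus> \<psi>) \<le> 1" using unit by (simp add: unit_valued_def)
    ultimately show ?case using add[of \<phi> \<psi>] by (simp add: eval_Iff[OF unit] eval_derived)
  next
    case (fp_mp \<Phi> \<Psi>)
    show ?case by (rule eval_mp[OF unit fp_mp.IH])
  qed (simp_all add: eval_Iff[OF unit] neg luk)
  then show ?thesis using unit by (simp add: fp_state_def)
qed

lemma fp_state_convex:
  assumes s: "fp_state s" and t: "fp_state t" and l: "0 \<le> l" "l \<le> 1"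
  shows "fp_state (\<lambda>\<phi>. (1 - l) * s \<phi> + l * t \<phi>)"
proof (rule additive_state_fp)
  have s: "additive_state s" and t: "additive_state t" using s t by (simp_all add: fp_state_additive)
  have le: "(1 - l) * a + l * b \<le> (1 - l) * a' + l * b'" if "a \<le> a'" "b \<le> b'" for a b a' b' :: real
    using that l by (intro add_mono mult_left_mono) simp_all
  show "additive_state (\<lambda>\<phi>. (1 - l) * s \<phi> + l * t \<phi>)"
    unfolding additive_state_def
  proof (intro conjI allI impI)
    fix \<phi> \<psi>
    show "0 \<le> (1 - l) * s \<phi> + l * t \<phi>" "(1 - l) * s \<phi> + l * t \<phi> \<le> 1"
      using le[of 0 "s \<phi>" 0 "t \<phi>"] le[of "s \<phi>" 1 "t \<phi>" 1] s t by (simp_all add: additive_state_def)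
    show "(1 - l) * s \<phi> + l * t \<phi> = 1" if "\<turnstile>\<^sub>L \<phi>"
      using that s t by (simp add: additive_state_def)
    show "(1 - l) * s (\<^bold>\<not> \<phi>) + l * t (\<^bold>\<not> \<phi>) = 1 - ((1 - l) * s \<phi> + l * t \<phi>)"
    proof -
      have "s (\<^bold>\<not> \<phi>) = 1 - s \<phi>" "t (\<^bold>\<not> \<phi>) = 1 - t \<phi>"
        using s t by (simp_all add: additive_state_def)
      then show ?thesis by (simp only:) (simp add: algebra_simps)
    qed
    show "(1 - l) * s (\<phi> \<^bold>\<rightarrow> \<psi>) + l * t (\<phi> \<^bold>\<rightarrow> \<psi>)
        \<le> 1 - ((1 - l) * s \<phi> + l * t \<phi>) + ((1 - l) * s \<psi> + l * t \<psi>)"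
    proof -
      have "(1 - l) * s (\<phi> \<^bold>\<rightarrow> \<psi>) + l * t (\<phi> \<^bold>\<rightarrow> \<psi>) \<le> (1 - l) * (1 - s \<phi> + s \<psi>) + l * (1 - t \<phi> + t \<psi>)"
        using s t by (intro le) (simp_all add: additive_state_def)
      then show ?thesis by (simp add: algebra_simps)
    qed
    have "s (\<phi> \<^bold>\<oplus> \<psi>) + s (\<phi> \<^bold>\<odot> \<psi>) = s \<phi> + s \<psi>" "t (\<phi> \<^bold>\<oplus> \<psi>) + t (\<phi> \<^bold>\<odot> \<psi>) = t \<phi> + t \<psi>"
      using s t by (simp_all add: additive_state_def)
    then have "(1 - l) * (s (\<phi> \<^bold>\<oplus> \<psi>) + s (\<phi> \<^bold>\<odot> \<psi>)) + l * (t (\<phi> \<^bold>\<oplus> \<psi>) + t (\<phi> \<^bold>\<odot> \<psi>))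
        = (1 - l) * (s \<phi> + s \<psi>) + l * (t \<phi> + t \<psi>)" by simp
    then show "(1 - l) * s (\<phi> \<^bold>\<oplus> \<psi>) + l * t (\<phi> \<^bold>\<oplus> \<psi>) + ((1 - l) * s (\<phi> \<^bold>\<odot> \<psi>) + l * t (\<phi> \<^bold>\<odot> \<psi>))
        = (1 - l) * s \<phi> + l * t \<phi> + ((1 - l) * s \<psi> + l * t \<psi>)"
      by (simp add: algebra_simps)
  qed
qed

lemma fp_state_valuation: assumes "unit_valued e" shows "fp_state (eval e)"
  unfolding fp_state_def
proof (intro conjI allI impI)
  show "unit_valued (eval e)" using eval_range[OF assms] by (simp add: unit_valued_def)
  fix \<Phi> :: mfm
  assume "\<turnstile>\<^sub>F\<^sub>P \<Phi>"
  then show "eval (eval e) \<Phi> = 1"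
    using luk_thm_sound[OF fp_flatten assms, of \<Phi>] by (simp add: eval_subst)
qed

lemma fp_state_event_subst: assumes "fp_state s" shows "fp_state (\<lambda>\<phi>. s (subst e \<phi>))"
  unfolding fp_state_def
proof (intro conjI allI impI)
  show "unit_valued (\<lambda>\<phi>. s (subst e \<phi>))" using assms by (simp add: fp_state_def unit_valued_def)
  fix \<Phi> :: mfm
  assume "\<turnstile>\<^sub>F\<^sub>P \<Phi>"
  then have "eval s (subst (\<lambda>\<phi>. Pr (subst e \<phi>)) \<Phi>) = 1"
    using assms fp_event_subst by (simp add: fp_state_def)
  then show "eval (\<lambda>\<phi>. s (subst e \<phi>)) \<Phi> = 1" by (simp add: eval_subst)
qed


section \<open>From partial states to states\<close>

section \<open>Extending partial states\<close>

text \<open>Truncates \<open>n * a - m\<close> to [0, 1]. As \<open>m\<close> is an integer, the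
  base case is constant; the recursion adds \<open>a\<close> once, using the adjacent levels
  \<open>m\<close> and \<open>m - 1\<close>.\<close>

primrec clip :: "'a \<Rightarrow> nat \<Rightarrow> int \<Rightarrow> 'a fm" where
  "clip a 0 m = (if m < 0 then \<^bold>\<top> else \<^bold>\<bottom>)"
| "clip a (Suc n) m = (clip a n m \<^bold>\<oplus> Atom a) \<^bold>\<odot> clip a n (m - 1)"

lemma atoms_clip: "atoms (clip a n m) \<subseteq> {a}"
  by (induction n arbitrary: m) auto

lemma eval_clip:
  assumes "unit_valued v" shows "eval v (clip a n m) = max 0 (min 1 (n * v a - m))"
proof (induction n arbitrary: m)
  case 0
  then show ?case by (auto simp: eval_derived max_def min_def)
next
  case (Suc n)
  have "0 \<le> v a" "v a \<le> 1" using assms by (simp_all add: unit_valued_def)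
  then show ?case by (auto simp: eval_derived Suc max_def min_def algebra_simps)
qed

lemma separating_formula:
  assumes v: "unit_valued v" and w: "unit_valued w" and ne: "v a \<noteq> w a"
  obtains \<phi> where "atoms \<phi> \<subseteq> {a}" "eval v \<phi> = 1" "eval w \<phi> < 1"
proof (cases "v a > w a")
  case True
  \<comment> \<open>A slope that stretches the gap beyond 1 leaves room for an integral
    cutoff.\<close>
  obtain n :: nat where n: "1 < n * (v a - w a)"
    using True ex_less_of_nat_mult[of "v a - w a" 1] by auto
  let ?m = "\<lfloor>n * v a\<rfloor> - 1"
  have "n * v a - ?m \<ge> 1" "n * w a - ?m < 1" using n by (simp_all add: algebra_simps) linarith+
  then show thesis
    using that[of "clip a n ?m"] atoms_clip[of a n ?m] by (simp add: eval_clip[OF v] eval_clip[OF w])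
next
  case False
  then obtain n :: nat where n: "1 < n * (w a - v a)"
    using ne ex_less_of_nat_mult[of "w a - v a" 1] by auto
  \<comment> \<open>This cutoff sends \<open>v\<close> to 0 and \<open>w\<close> above 0; negation
    then exchanges the roles.\<close>
  let ?m = "\<lceil>n * v a\<rceil>"
  have "n * v a - ?m \<le> 0" "n * w a - ?m > 0" using n by (simp_all add: algebra_simps) linarith+
  then have "eval v (clip a n ?m) = 0" "eval w (clip a n ?m) > 0"
    unfolding eval_clip[OF v] eval_clip[OF w] by linarith+
  then show thesis
    using that[of "\<^bold>\<not> (clip a n ?m)"] atoms_clip[of a n ?m] by simp
qed

text \<open>
  This replaces a completeness theorem for FP: only the theorems over the atoms in \<open>B\<close> are used,
  which is all that a probabilistic substitution with domain \<open>B\<close> preserves.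
\<close>

lemma fp_state_extend:
  assumes v: "unit_valued v" and sound: "\<And>\<Phi>. atoms \<Phi> \<subseteq> B \<Longrightarrow> \<turnstile>\<^sub>F\<^sub>P \<Phi> \<Longrightarrow> eval v \<Phi> = 1"
  obtains s where "fp_state s" "\<And>\<phi>. \<phi> \<in> B \<Longrightarrow> s \<phi> = v \<phi>"
proof -
  \<comment> \<open>The filter generated by the FP theorems and the formulas over \<open>B\<close>
    true at \<open>v\<close>. The latter are closed under strong conjunction, so one
    \<open>\<Phi>\<close> suffices as a witness.\<close>
  define G where "G = {x. \<exists>\<Phi>. atoms \<Phi> \<subseteq> B \<and> eval v \<Phi> = 1 \<and> \<sim> cls \<Phi> \<oplus> x \<in> fp_filter}"
  have fp_G: "fp_filter \<subseteq> G"
    unfolding G_def by (auto intro!: exI[of _ "\<^bold>\<top>"] simp: eval_derived)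
  have cls_G: "cls \<Phi> \<in> G" if "atoms \<Phi> \<subseteq> B" "eval v \<Phi> = 1" for \<Phi>
    unfolding G_def using that by (auto intro!: exI[of _ \<Phi>])
  have filter_G: "mv_filter G"
    unfolding mv_filter_def
  proof (intro conjI allI impI)
    show "\<one> \<in> G" using fp_G by auto
    fix x y assume "x \<in> G" "\<sim> x \<oplus> y \<in> G"
    then obtain \<Phi> \<Psi> where \<Phi>: "atoms \<Phi> \<subseteq> B" "eval v \<Phi> = 1" "\<sim> cls \<Phi> \<oplus> x \<in> fp_filter"
      and \<Psi>: "atoms \<Psi> \<subseteq> B" "eval v \<Psi> = 1" "\<sim> cls \<Psi> \<oplus> (\<sim> x \<oplus> y) \<in> fp_filter"
      unfolding G_def by blast
    have "(\<sim> cls \<Phi> \<oplus> x) \<otimes> (\<sim> x \<oplus> (\<sim> cls \<Psi> \<oplus> y)) \<in> fp_filter"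
      using \<Phi> \<Psi> mv_left_commute[of "\<sim> x"] by (auto intro: mv_filter_times[OF fp.filter])
    then have "\<sim> cls \<Phi> \<oplus> (\<sim> cls \<Psi> \<oplus> y) \<in> fp_filter"
      by (rule mv_filter_up[OF fp.filter _ mv_le_impl_trans])
    then have "\<sim> cls (\<Phi> \<^bold>\<odot> \<Psi>) \<oplus> y \<in> fp_filter" by (simp add: mv_neg_times mv_assoc)
    then show "y \<in> G" unfolding G_def using \<Phi> \<Psi> by (auto intro!: exI[of _ "\<Phi> \<^bold>\<odot> \<Psi>"] simp: eval_derived)
  qed
  have "\<zero> \<notin> G"
  proof
    assume "\<zero> \<in> G"
    then obtain \<Phi> where \<Phi>: "atoms \<Phi> \<subseteq> B" "eval v \<Phi> = 1" "cls (\<^bold>\<not> \<Phi>) \<in> fp_filter"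
      unfolding G_def by auto
    then have "\<turnstile>\<^sub>F\<^sub>P \<^bold>\<not> \<Phi>" by (simp only: cls_in_fp_filter)
    then show False using sound[of "\<^bold>\<not> \<Phi>"] \<Phi> by simp
  qed
  then obtain H where H: "mv_prime H" "G \<subseteq> H" by (rule mv_prime_exists[OF filter_G])
  interpret mv_prime_locale H by unfold_locales (rule H)
  define s where "s \<phi> = val (cls (Pr \<phi>))" for \<phi>
  have s: "unit_valued s" by (simp add: unit_valued_def s_def val_bounds)
  have eval_s: "eval s \<Phi> = val (cls \<Phi>)" for \<Phi>
    by (induction \<Phi>) (simp_all add: s_def val_zero val_neg val_plus)
  show thesis
  proof
    have "eval s \<Phi> = 1" if "\<turnstile>\<^sub>F\<^sub>P \<Phi>" for \<Phi>
    proof -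
      have "cls \<Phi> \<in> H" using that fp_G H cls_in_fp_filter by blast
      then show ?thesis by (simp add: eval_s val_in)
    qed
    then show "fp_state s" using s by (simp add: fp_state_def)
    show "s \<phi> = v \<phi>" if "\<phi> \<in> B" for \<phi>
    \<comment> \<open>A formula separating \<open>v\<close> from \<open>s\<close> would be true at
      \<open>v\<close>, hence lie in \<open>H\<close>, hence have value 1 under \<open>s\<close>
      too.\<close>
    proof (rule ccontr)
      assume "s \<phi> \<noteq> v \<phi>"
      then obtain \<Phi> where "atoms \<Phi> \<subseteq> {\<phi>}" "eval v \<Phi> = 1" "eval s \<Phi> < 1"
        using separating_formula[OF v s] by metis
      moreover then have "cls \<Phi> \<in> H" using that cls_G H by blast
      ultimately show False by (simp add: eval_s val_in)
    qed
  qed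
qed

section \<open>Angular displacement: lifts, uniform bound, monotonicity\<close>

section \<open>Displacement along segments of states\<close>

text \<open>The difference of two logarithms of one function has values in the integer multiples of
  \<open>2 * pi * \<i>\<close>, a discrete set, so it is constant on a connected set. Displacements
  therefore do not depend on the lift.\<close>

lemma log_lift_unique:
  fixes g h :: "'a::topological_space \<Rightarrow> complex"
  assumes S: "connected S" and g: "continuous_on S g" and h: "continuous_on S h"
    and eq: "\<And>z. z \<in> S \<Longrightarrow> exp (g z) = exp (h z)" and zw: "z \<in> S" "w \<in> S"
  shows "g z - g w = h z - h w"
proof -
  have "(\<lambda>z. g z - h z) constant_on S"
  proof (rule continuous_discrete_range_constant[OF S])
    show "continuous_on S (\<lambda>z. g z - h z)" using g h by (rule continuous_on_diff)
    fix x assume x: "x \<in> S"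
    have "2 * pi \<le> norm ((g y - h y) - (g x - h x))" if y: "y \<in> S" and ne: "g y - h y \<noteq> g x - h x" for y
    proof (rule ccontr)
      assume lt: "\<not> 2 * pi \<le> norm ((g y - h y) - (g x - h x))"
      have "g y - g x = h y - h x"
      proof (rule exp_complex_eqI)
        show "\<bar>Im (g y - g x) - Im (h y - h x)\<bar> < 2 * pi"
          using abs_Im_le_cmod[of "(g y - h y) - (g x - h x)"] lt by simp
        show "exp (g y - g x) = exp (h y - h x)" using eq x y by (simp add: exp_diff)
      qed
      then show False using ne by (simp add: algebra_simps)
    qed
    then show "\<exists>e>0. \<forall>y. y \<in> S \<and> g y - h y \<noteq> g x - h x \<longrightarrow> e \<le> norm ((g y - h y) - (g x - h x))"
      by (intro exI[of _ "2 * pi"]) auto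
  qed
  then obtain c where "\<And>z. z \<in> S \<Longrightarrow> g z - h z = c" unfolding constant_on_def by blast
  from this[OF zw(1)] this[OF zw(2)] show ?thesis by (simp add: algebra_simps)
qed

text \<open>While the ratio avoids the nonpositive real axis, its principal logarithm is itself a
  lift, and the imaginary part of that is at most \<open>pi\<close> in modulus.\<close>

lemma log_displacement_le_pi:
  assumes g: "continuous_on {a..b} g" and ab: "a \<le> (b::real)"
    and nonpos: "\<And>l. l \<in> {a..b} \<Longrightarrow> exp (g l) / exp (g a) \<notin> \<real>\<^sub>\<le>\<^sub>0"
  shows "\<bar>Im (g b) - Im (g a)\<bar> \<le> pi"
proof -
  let ?h = "\<lambda>l. Ln (exp (g l) / exp (g a))"
  have h: "continuous_on {a..b} ?h"
    using g nonpos by (intro continuous_intros) auto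
  have "(g b - g a) - (g a - g a) = ?h b - ?h a"
    by (rule log_lift_unique[of "{a..b}"])
      (use g h ab in \<open>auto intro!: continuous_intros simp: exp_diff\<close>)
  then have "g b - g a = ?h b" by simp
  then have "Im (g b) - Im (g a) = Im (?h b)" by (metis minus_complex.simps(2))
  then show ?thesis
    using mpi_less_Im_Ln[of "exp (g b) / exp (g a)"] Im_Ln_le_pi[of "exp (g b) / exp (g a)"] by simp
qed

lemma log_displacement_bound:
  assumes g: "continuous_on {0..1::real} g" and N: "0 < (N::nat)"
    and nonpos: "\<And>l l'. l \<in> {0..1} \<Longrightarrow> l' \<in> {0..1} \<Longrightarrow> \<bar>l - l'\<bar> \<le> 1 / N \<Longrightarrow> exp (g l) / exp (g l') \<notin> \<real>\<^sub>\<le>\<^sub>0"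
  shows "\<bar>Im (g 1) - Im (g 0)\<bar> \<le> N * pi"
proof -
  have "\<bar>Im (g (i / N)) - Im (g 0)\<bar> \<le> i * pi" if "i \<le> N" for i :: nat
    using that
  proof (induction i)
    case (Suc i)
    have sub: "{i / N..Suc i / N} \<subseteq> {0..1}"
      using Suc.prems N by (auto simp: field_simps dest: order_trans)
    have "\<bar>Im (g (Suc i / N)) - Im (g (i / N))\<bar> \<le> pi"
    proof (rule log_displacement_le_pi)
      show "continuous_on {i / N..Suc i / N} g" using g sub by (rule continuous_on_subset)
      show le: "i / N \<le> Suc i / N" by (simp add: divide_right_mono)
      fix l assume l: "l \<in> {i / N..Suc i / N}"
      show "exp (g l) / exp (g (i / N)) \<notin> \<real>\<^sub>\<le>\<^sub>0"
      proof (rule nonpos)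
        show "l \<in> {0..1}" using l sub by blast
        show "i / N \<in> {0..1}" using le sub by auto
        show "\<bar>l - i / N\<bar> \<le> 1 / N" using l by (simp add: add_divide_distrib)
      qed
    qed
    then show ?case using Suc by (simp add: algebra_simps)
  qed simp
  from this[of N] N show ?thesis by simp
qed

definition seg :: "('a \<Rightarrow> real) \<Rightarrow> ('a \<Rightarrow> real) \<Rightarrow> real \<Rightarrow> 'a \<Rightarrow> real" where
  "seg s t l = (\<lambda>a. (1 - l) * s a + l * t a)"

lemma seg_simps [simp]: "seg s t 0 = s" "seg s t 1 = t" "seg s s l = s"
  by (simp_all add: seg_def algebra_simps)

lemma fp_state_seg: "fp_state s \<Longrightarrow> fp_state t \<Longrightarrow> l \<in> {0..1} \<Longrightarrow> fp_state (seg s t l)"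
  unfolding seg_def by (rule fp_state_convex) auto

lemma continuous_on_eval:
  assumes "\<And>a. a \<in> atoms \<phi> \<Longrightarrow> continuous_on X (\<lambda>x. w x a)"
  shows "continuous_on X (\<lambda>x. eval (w x) \<phi>)"
  using assms by (induction \<phi>) (auto intro!: continuous_intros)

lemma continuous_on_seg: "continuous_on X (\<lambda>l. seg s t l a)"
  unfolding seg_def by (intro continuous_intros)

text \<open>The constant is uniform in the valuations, since one bound has to serve all segments of
  states at once.\<close>

lemma eval_lipschitz:
  "\<exists>L\<ge>0. \<forall>v w d. (\<forall>a. \<bar>v a - w a\<bar> \<le> d) \<longrightarrow> \<bar>eval v \<phi> - eval w \<phi>\<bar> \<le> L * d"
proof (induction \<phi>)
  case (Atom a)
  show ?case by (intro exI[of _ 1]) auto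
next
  case (Neg \<phi>)
  then show ?case by (simp add: abs_minus_commute)
next
  case (Oplus \<phi> \<psi>)
  then obtain L M where L: "0 \<le> L" "\<And>v w d. (\<forall>a. \<bar>v a - w a\<bar> \<le> d) \<Longrightarrow> \<bar>eval v \<phi> - eval w \<phi>\<bar> \<le> L * d"
    and M: "0 \<le> M" "\<And>v w d. (\<forall>a. \<bar>v a - w a\<bar> \<le> d) \<Longrightarrow> \<bar>eval v \<psi> - eval w \<psi>\<bar> \<le> M * d"
    by blast
  have "\<bar>eval v (\<phi> \<^bold>\<oplus> \<psi>) - eval w (\<phi> \<^bold>\<oplus> \<psi>)\<bar> \<le> (L + M) * d" if "\<forall>a. \<bar>v a - w a\<bar> \<le> d" for v w d
    using L(2)[OF that] M(2)[OF that] unfolding eval.simps distrib_right by linarith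
  then show ?case using L(1) M(1) by (intro exI[of _ "L + M"]) auto
qed (intro exI[of _ 0], simp)

text \<open>Centring the square at the origin keeps its boundary away from 0, so that the
  exponential serves as covering map.\<close>

definition pos :: "'a fm \<Rightarrow> 'a fm \<Rightarrow> ('a \<Rightarrow> real) \<Rightarrow> complex" where
  "pos x y s = Complex (eval s x - 1/2) (eval s y - 1/2)"

definition Bd :: "'a fm \<Rightarrow> 'a fm \<Rightarrow> 'a fm" where
  "Bd x y = (x \<^bold>\<or> \<^bold>\<not> x) \<^bold>\<or> (y \<^bold>\<or> \<^bold>\<not> y)"

lemma continuous_on_pos:
  assumes "\<And>a. a \<in> atoms x \<union> atoms y \<Longrightarrow> continuous_on X (\<lambda>z. w z a)"
  shows "continuous_on X (\<lambda>z. pos x y (w z))"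
proof -
  have "pos x y v = of_real (eval v x - 1/2) + \<i> * of_real (eval v y - 1/2)" for v
    by (simp add: pos_def complex_eq_iff)
  then show ?thesis
    using assms by (simp only:) (intro continuous_intros continuous_on_eval; simp)
qed

lemma eval_Bd:
  assumes s: "fp_state s" and bd: "\<turnstile>\<^sub>F\<^sub>P Bd x y"
  shows "eval s x = 0 \<or> eval s x = 1 \<or> eval s y = 0 \<or> eval s y = 1"
proof -
  have "unit_valued s" "eval s (Bd x y) = 1" using s bd by (auto simp: fp_state_def)
  then show ?thesis by (simp add: Bd_def eval_Disj max_def split: if_splits)
qed

lemma norm_pos_ge:
  assumes s: "fp_state s" and bd: "\<turnstile>\<^sub>F\<^sub>P Bd x y" shows "1/2 \<le> norm (pos x y s)"
  using eval_Bd[OF assms] abs_Re_le_cmod[of "pos x y s"] abs_Im_le_cmod[of "pos x y s"]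
  by (auto simp: pos_def)

text \<open>A lift is encoded as a continuous logarithm, its imaginary part being the angle. By
  \<open>log_lift_unique\<close> a segment contributes at most one value.\<close>

definition disps :: "mfm \<Rightarrow> mfm \<Rightarrow> real set" where
  "disps x y = {Im (g 1) - Im (g 0) | s t g. fp_state s \<and> fp_state t \<and> continuous_on {0..1} g
     \<and> (\<forall>l\<in>{0..1}. exp (g l) = pos x y (seg s t l))}"

lemma dispsI:
  assumes "fp_state s" "fp_state t" "continuous_on {0..1} g"
    and "\<And>l. l \<in> {0..1} \<Longrightarrow> exp (g l) = pos x y (seg s t l)"
  shows "Im (g 1) - Im (g 0) \<in> disps x y"
  unfolding disps_def using assms by blast

lemma disps_bounded:
  assumes bd: "\<turnstile>\<^sub>F\<^sub>P Bd x y" obtains C where "\<And>d. d \<in> disps x y \<Longrightarrow> d \<le> C"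
proof -
  obtain L where L: "0 \<le> L" "\<And>v w d. (\<forall>a. \<bar>v a - w a\<bar> \<le> d) \<Longrightarrow> \<bar>eval v x - eval w x\<bar> \<le> L * d"
    using eval_lipschitz[of x] by blast
  obtain M where M: "0 \<le> M" "\<And>v w d. (\<forall>a. \<bar>v a - w a\<bar> \<le> d) \<Longrightarrow> \<bar>eval v y - eval w y\<bar> \<le> M * d"
    using eval_lipschitz[of y] by blast
  \<comment> \<open>With this many pieces the point moves by less than 1/2 along each, and 1/2
    bounds its distance from the centre from below.\<close>
  obtain N :: nat where "2 * (L + M) < N" using reals_Archimedean2 by blast
  then have N: "0 < N" "2 * (L + M) < N" using L(1) M(1) by (auto intro: Nat.gr0I)
  have "d \<le> N * pi" if "d \<in> disps x y" for d
  proof -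
    from that obtain s t g where d: "d = Im (g 1) - Im (g 0)" and st: "fp_state s" "fp_state t"
      and g: "continuous_on {0..1} g" "\<And>l. l \<in> {0..1} \<Longrightarrow> exp (g l) = pos x y (seg s t l)"
      unfolding disps_def by blast
    have "\<bar>Im (g 1) - Im (g 0)\<bar> \<le> N * pi"
    proof (rule log_displacement_bound[OF g(1) N(1)])
      fix l l' :: real assume l: "l \<in> {0..1}" "l' \<in> {0..1}" and close: "\<bar>l - l'\<bar> \<le> 1 / N"
      let ?z = "pos x y (seg s t l)" and ?w = "pos x y (seg s t l')"
      have "\<bar>seg s t l a - seg s t l' a\<bar> \<le> 1 / N" for a
      proof -
        have "seg s t l a - seg s t l' a = (l - l') * (t a - s a)" by (simp add: seg_def algebra_simps)
        moreover have "\<bar>t a - s a\<bar> \<le> 1"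
          using st by (auto simp: fp_state_def unit_valued_def abs_le_iff add_increasing)
            (smt (verit))+
        ultimately have "\<bar>seg s t l a - seg s t l' a\<bar> \<le> \<bar>l - l'\<bar> * 1"
          by (simp add: abs_mult mult_left_le)
        then show ?thesis using close by simp
      qed
      then have "\<bar>eval (seg s t l) x - eval (seg s t l') x\<bar> \<le> L * (1 / N)"
        "\<bar>eval (seg s t l) y - eval (seg s t l') y\<bar> \<le> M * (1 / N)"
        using L M by blast+
      then have "norm (?z - ?w) \<le> (L + M) / N"
        using cmod_le[of "?z - ?w"] by (simp add: pos_def add_divide_distrib)
      also have "\<dots> < 1 / 2" using N by (simp add: field_simps)
      also have "\<dots> \<le> norm ?w" using st l bd by (intro norm_pos_ge fp_state_seg)
      finally have close: "norm (?z - ?w) < norm ?w" .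
      \<comment> \<open>A point on the opposite ray would be at distance at least
        \<open>norm ?w\<close> from \<open>?w\<close>.\<close>
      show "exp (g l) / exp (g l') \<notin> \<real>\<^sub>\<le>\<^sub>0"
      proof
        assume "exp (g l) / exp (g l') \<in> \<real>\<^sub>\<le>\<^sub>0"
        then obtain r where r: "r \<le> 0" "?z / ?w = of_real r" using g(2) l by (auto elim: nonpos_Reals_cases)
        have "?w \<noteq> 0" using close by auto
        then have "?z - ?w = of_real (r - 1) * ?w" using r by (simp add: field_simps)
        then have "norm (?z - ?w) = \<bar>r - 1\<bar> * norm ?w" by (simp only: norm_mult norm_of_real)
        moreover have "1 * norm ?w \<le> \<bar>r - 1\<bar> * norm ?w" using r by (intro mult_right_mono) auto
        ultimately show False using close by simp
      qed
    qed
    then show ?thesis by (simp add: d)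
  qed
  then show thesis by (rule that)
qed

lemma disps_nonempty: assumes bd: "\<turnstile>\<^sub>F\<^sub>P Bd x y" shows "disps x y \<noteq> {}"
proof -
  have s: "fp_state (eval (\<lambda>_. 0))" by (rule fp_state_valuation) (simp add: unit_valued_def)
  then have "pos x y (eval (\<lambda>_. 0)) \<noteq> 0" using norm_pos_ge[OF s bd] by auto
  then have "exp (Ln (pos x y (eval (\<lambda>_. 0)))) = pos x y (eval (\<lambda>_. 0))" by (rule exp_Ln)
  then show ?thesis
    using dispsI[OF s s continuous_on_const[of _ "Ln (pos x y (eval (\<lambda>_. 0)))"], of x y] by auto
qed

lemma eval_fp_iff: "fp_state s \<Longrightarrow> \<turnstile>\<^sub>F\<^sub>P \<Phi> \<^bold>\<leftrightarrow> \<Psi> \<Longrightarrow> eval s \<Phi> = eval s \<Psi>"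
  using eval_Iff[of s \<Phi> \<Psi>] by (simp add: fp_state_def)

text \<open>
  The factor \<open>\<delta>\<close> carries a segment to a path of partial states on \<open>B\<close>. These extend to states, so
  the path can be straightened inside the convex set of states without changing the lifted end points.
\<close>

lemma disps_factor:
  assumes bd: "\<turnstile>\<^sub>F\<^sub>P Bd x y" and \<delta>: "prob_subst B \<delta>" and B: "atoms x \<subseteq> B" "atoms y \<subseteq> B"
    and xy': "\<turnstile>\<^sub>F\<^sub>P x' \<^bold>\<leftrightarrow> subst \<delta> x" "\<turnstile>\<^sub>F\<^sub>P y' \<^bold>\<leftrightarrow> subst \<delta> y"
  shows "disps x' y' \<subseteq> disps x y"
proof
  fix d assume "d \<in> disps x' y'"
  then obtain s t g where d: "d = Im (g 1) - Im (g 0)" and st: "fp_state s" "fp_state t"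
    and g: "continuous_on {0..1} g" "\<And>l. l \<in> {0..1} \<Longrightarrow> exp (g l) = pos x' y' (seg s t l)"
    unfolding disps_def by blast
  define u where "u l \<phi> = eval (seg s t l) (\<delta> \<phi>)" for l \<phi>
  \<comment> \<open>Only the values on \<open>B\<close> are prescribed and continuous in
    \<open>l\<close>; the states chosen for different \<open>l\<close> need not fit together
    elsewhere. This suffices because \<open>x\<close> and \<open>y\<close> have all their atoms in
    \<open>B\<close>.\<close>
  have "\<exists>r. fp_state r \<and> (\<forall>\<phi>\<in>B. r \<phi> = u l \<phi>)" if l: "l \<in> {0..1}" for l
  proof -
    have state: "fp_state (seg s t l)" using st l by (rule fp_state_seg)
    have "unit_valued (u l)"
      using eval_range[of "seg s t l"] state by (simp add: unit_valued_def u_def fp_state_def)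
    moreover have "eval (u l) \<Phi> = 1" if "atoms \<Phi> \<subseteq> B" "\<turnstile>\<^sub>F\<^sub>P \<Phi>" for \<Phi>
    proof -
      have "\<turnstile>\<^sub>F\<^sub>P subst \<delta> \<Phi> \<^bold>\<leftrightarrow> subst \<delta> \<^bold>\<top>"
        using \<delta> that unfolding prob_subst_def by (simp add: fp_iff_Top del: subst_derived)
      then have "eval (seg s t l) (subst \<delta> \<Phi>) = 1"
        using state by (simp add: fp_iff_Top fp_state_def)
      then show ?thesis by (simp add: eval_subst u_def[abs_def])
    qed
    ultimately show ?thesis using fp_state_extend by metis
  qed
  then obtain r where r: "\<And>l. l \<in> {0..1} \<Longrightarrow> fp_state (r l)"
    and rB: "\<And>l \<phi>. l \<in> {0..1} \<Longrightarrow> \<phi> \<in> B \<Longrightarrow> r l \<phi> = u l \<phi>" by metis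
  \<comment> \<open>Homotopy from the path \<open>r\<close> to the straight segment between its end
    points, which stay fixed; by convexity every value is a state.\<close>
  define H where "H z = seg (r (fst z)) (seg (r 0) (r 1) (fst z)) (snd z)" for z :: "real \<times> real"
  define Q where "Q = {0..1::real} \<times> {0..1::real}"
  have H: "fp_state (H z)" if "z \<in> Q" for z
    using that r unfolding H_def Q_def by (auto intro!: fp_state_seg)
  have cont_u: "continuous_on X (\<lambda>l. u l \<phi>)" for X \<phi>
    unfolding u_def by (intro continuous_on_eval continuous_on_seg)
  have "continuous_on Q (\<lambda>z. H z \<phi>)" if "\<phi> \<in> B" for \<phi>
  proof -
    have "continuous_on Q (\<lambda>z. (1 - snd z) * u (fst z) \<phi> + snd z * ((1 - fst z) * u 0 \<phi> + fst z * u 1 \<phi>))"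
      by (intro continuous_intros continuous_on_compose2[OF cont_u[of UNIV]]) auto
    then show ?thesis
      by (rule continuous_on_eq) (use that rB in \<open>auto simp: H_def seg_def Q_def\<close>)
  qed
  then have "continuous_on Q (\<lambda>z. pos x y (H z))" using B by (intro continuous_on_pos) auto
  moreover have "contractible Q" unfolding Q_def by (intro convex_imp_contractible convex_Times) auto
  moreover have "pos x y (H z) \<noteq> 0" if "z \<in> Q" for z using norm_pos_ge[OF H[OF that] bd] by auto
  ultimately obtain G where G: "continuous_on Q G" "\<And>z. z \<in> Q \<Longrightarrow> pos x y (H z) = exp (G z)"
    using continuous_logarithm_on_contractible by metis
  have contG: "continuous_on {0..1} (\<lambda>l. G (l, m))" "continuous_on {0..1} (\<lambda>m'. G (m, m'))"
    if "m \<in> {0..1}" for m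
    using that by (auto simp: Q_def intro!: continuous_on_compose2[OF G(1)] continuous_intros)
  have pos_r: "pos x y (r l) = pos x' y' (seg s t l)" if l: "l \<in> {0..1}" for l
  proof -
    have "eval (r l) \<Phi> = eval (seg s t l) (subst \<delta> \<Phi>)" if "atoms \<Phi> \<subseteq> B" for \<Phi>
      unfolding eval_subst u_def[symmetric] using that rB l by (intro eval_cong) auto
    then show ?thesis
      using eval_fp_iff[OF fp_state_seg[OF st l]] xy' B by (simp add: pos_def)
  qed
  have "g 1 - g 0 = G (1, 0) - G (0, 0)"
  proof (rule log_lift_unique[OF _ g(1) contG(1)[of 0]])
    fix l :: real assume l: "l \<in> {0..1}"
    then have "(l, 0) \<in> Q" "H (l, 0) = r l" by (auto simp: Q_def H_def)
    then show "exp (g l) = exp (G (l, 0))" using G(2)[of "(l, 0)"] g(2)[OF l] pos_r[OF l] by simp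
  qed auto
  \<comment> \<open>The homotopy is constant on these two sides of the parameter square, so the lift
    does not move along them.\<close>
  moreover have "G (m, 1) - G (m, 0) = G (m, 0) - G (m, 0)" if m: "m = 0 \<or> m = 1" for m
  proof (rule log_lift_unique[OF _ contG(2)[of m] continuous_on_const[of _ "G (m, 0)"]])
    fix m' :: real assume "m' \<in> {0..1}"
    then have "(m, m') \<in> Q" "(m, 0) \<in> Q" "H (m, m') = H (m, 0)" using m by (auto simp: Q_def H_def)
    then show "exp (G (m, m')) = exp (G (m, 0))" by (metis G(2))
  qed (use m in auto)
  from this[of 0] this[of 1] have "G (0, 1) = G (0, 0)" "G (1, 1) = G (1, 0)" by simp_all
  ultimately have "g 1 - g 0 = G (1, 1) - G (0, 1)" by simp
  then have "d = Im (G (1, 1)) - Im (G (0, 1))" by (simp add: d complex_eq_iff)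
  moreover have "exp (G (l, 1)) = pos x y (seg (r 0) (r 1) l)" if "l \<in> {0..1}" for l :: real
    using G(2)[of "(l, 1)"] that by (simp add: Q_def H_def)
  ultimately show "d \<in> disps x y"
    using dispsI[OF r[of 0] r[of 1] contG(1)[of 1]] by simp
qed

section \<open>Rotated unifiers and the absence of maximal classes\<close>

section \<open>The square problem is nullary\<close>

definition Rot :: "'a fm \<Rightarrow> 'a fm \<Rightarrow> 'a fm \<Rightarrow> 'a fm" where
  "Rot x y q = (x \<^bold>\<oplus> q \<^bold>\<odot> \<^bold>\<not> y) \<^bold>\<odot> \<^bold>\<not> (q \<^bold>\<odot> y) \<^bold>\<or> q \<^bold>\<odot> \<^bold>\<not> y"

lemma cls_Rot: "cls (Rot x y q) = mv_rot (cls x) (cls y) (cls q)"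
  by (simp add: Rot_def mv_rot_def)

lemma subst_Rot: "subst \<sigma> (Rot x y q) = Rot (subst \<sigma> x) (subst \<sigma> y) (subst \<sigma> q)"
  by (simp add: Rot_def)

lemma cls_Bd: "cls (Bd x y) = mv_bd (cls x) (cls y)"
  by (simp add: Bd_def mv_bd_def)

lemma fp_Bd_Rot:
  assumes "\<turnstile>\<^sub>F\<^sub>P Bd x y" shows "\<turnstile>\<^sub>F\<^sub>P Bd (Rot x y q) (Rot y (\<^bold>\<not> x) q)"
  using assms mv_bd_rot[OF fp.filter, of "cls x" "cls y" "cls q"]
  by (simp add: cls_Bd cls_Rot flip: cls_in_fp_filter)

definition rot :: "real \<Rightarrow> real \<Rightarrow> real \<Rightarrow> real" where
  "rot a b q = max (max 0 (min 1 (a + max 0 (q - b)) - max 0 (q + b - 1))) (max 0 (q - b))"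

lemma eval_Rot:
  assumes "unit_valued v" shows "eval v (Rot x y q) = rot (eval v x) (eval v y) (eval v q)"
  by (simp add: Rot_def eval_Disj[OF assms] eval_derived rot_def algebra_simps)

lemma rot_edge:
  assumes "0 \<le> a" "a \<le> 1" "0 \<le> b" "b \<le> 1" "0 \<le> q" "q \<le> 1"
  shows "rot 0 b q = max 0 (q - b)" "rot 1 b q = 1 - max 0 (q + b - 1)"
    "rot a 0 q = min 1 (a + q)" "rot a 1 q = max 0 (a - q)"
  using assms by (auto simp: rot_def max_def min_def)

text \<open>Moving along at most a quarter of the perimeter never reaches the opposite ray from the
  centre; on each side this is a linear inequality given the sign of \<open>r\<close>.\<close>

lemma rot_not_opposite:
  assumes unit: "0 \<le> a" "a \<le> 1" "0 \<le> b" "b \<le> 1" "0 \<le> q" "q \<le> 1"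
    and edge: "a = 0 \<or> a = 1 \<or> b = 0 \<or> b = 1" and r: "r \<le> 0"
  shows "rot a b q - 1/2 \<noteq> r * (a - 1/2) \<or> rot b (1 - a) q - 1/2 \<noteq> r * (b - 1/2)"
proof (rule ccontr)
  assume "\<not> ?thesis"
  then have a': "rot a b q - 1/2 = r * (a - 1/2)" and b': "rot b (1 - a) q - 1/2 = r * (b - 1/2)" by auto
  have neg: "r * z \<le> 0" if "0 \<le> z" for z using that r by (rule mult_nonpos_nonneg[rotated])
  have pos: "0 \<le> r * z" if "z \<le> 0" for z using that r by (simp add: mult_nonpos_nonpos)
  have "0 \<le> 1 - a" "1 - a \<le> 1" using unit by simp_all
  note rots = rot_edge[OF unit] rot_edge[OF unit(3,4) this unit(5,6)]
  consider "a = 0" | "a = 1" | "b = 0" | "b = 1" using edge by blast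
  then show False
  proof cases
    case 1
    then have "max 0 (q - b) - 1/2 = - r / 2" "max 0 (b - q) - 1/2 = r * (b - 1/2)"
      using a' b' rots by simp_all
    then show False using pos[of "b - 1/2"] r unit by linarith
  next
    case 2
    then have "1 - max 0 (q + b - 1) - 1/2 = r / 2" "min 1 (b + q) - 1/2 = r * (b - 1/2)"
      using a' b' rots by simp_all
    then show False using neg[of "b - 1/2"] r unit by linarith
  next
    case 3
    then have "min 1 (a + q) - 1/2 = r * (a - 1/2)" "max 0 (q - (1 - a)) - 1/2 = - r / 2"
      using a' b' rots by simp_all
    then show False using neg[of "a - 1/2"] r unit by linarith
  next
    case 4
    then have "max 0 (a - q) - 1/2 = r * (a - 1/2)" "1 - max 0 (q + (1 - a) - 1) - 1/2 = r / 2"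
      using a' b' rots by simp_all
    then show False using pos[of "a - 1/2"] r unit by linarith
  qed
qed

text \<open>At amount 1 the shift along the perimeter is the Euclidean quarter turn
  \<open>(a, b)\<close> to \<open>(1 - b, a)\<close>, which is multiplication by \<open>\<i>\<close>
  after centring.\<close>

lemma rot_zero_one:
  assumes unit: "0 \<le> a" "a \<le> 1" "0 \<le> b" "b \<le> 1" and edge: "a = 0 \<or> a = 1 \<or> b = 0 \<or> b = 1"
  shows "rot a b 0 = a" "rot a b 1 = 1 - b"
  using assms by (auto simp: rot_def max_def min_def)

lemma disps_Rot:
  fixes m :: nat
  assumes bd: "\<turnstile>\<^sub>F\<^sub>P Bd x y" and fresh: "\<And>\<phi>. \<phi> \<in> atoms x \<union> atoms y \<Longrightarrow> m \<notin> atoms \<phi>"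
    and d: "d \<in> disps x y"
  shows "d + pi / 2 \<in> disps (Rot x y (Pr (Atom m))) (Rot y (\<^bold>\<not> x) (Pr (Atom m)))"
proof -
  from d obtain s t g where d: "d = Im (g 1) - Im (g 0)" and st: "fp_state s" "fp_state t"
    and g: "continuous_on {0..1} g" "\<And>l. l \<in> {0..1} \<Longrightarrow> exp (g l) = pos x y (seg s t l)"
    unfolding disps_def by blast
  let ?q = "Pr (Atom m)"
  \<comment> \<open>The fresh variable is false at the start and true at the end, so its value along
    the segment is the parameter \<open>l\<close>; freshness leaves \<open>x\<close> and
    \<open>y\<close> unaffected.\<close>
  define s' t' where "s' \<phi> = s (subst (Atom(m := \<^bold>\<bottom>)) \<phi>)" and "t' \<phi> = t (subst (Atom(m := \<^bold>\<top>)) \<phi>)" for \<phi>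
  have st': "fp_state s'" "fp_state t'"
    using fp_state_event_subst[OF st(1)] fp_state_event_subst[OF st(2)] by (simp_all add: s'_def[abs_def] t'_def[abs_def])
  have fix_event: "subst (Atom(m := \<psi>)) \<phi> = \<phi>" if "m \<notin> atoms \<phi>" for \<phi> \<psi>
    using that by (intro subst_id) auto
  have same: "eval (seg s' t' l) \<Phi> = eval (seg s t l) \<Phi>" if "atoms \<Phi> \<subseteq> atoms x \<union> atoms y" for l \<Phi>
    using that fresh by (intro eval_cong) (auto simp: seg_def s'_def t'_def fix_event)
  have "s \<^bold>\<bottom> = 0" using eval_fp_iff[OF st(1) fp_Bot] by simp
  moreover have "t \<^bold>\<top> = 1"
    using st(2) fp_nec[of "\<^bold>\<top>"] by (auto simp: fp_state_def luk_thm_iff_cls)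
  ultimately have q: "seg s' t' l (Atom m) = l" for l by (simp add: seg_def s'_def t'_def)
  define a b where "a l = eval (seg s t l) x" and "b l = eval (seg s t l) y" for l
  define z w where "z l = pos x y (seg s t l)"
    and "w l = pos (Rot x y ?q) (Rot y (\<^bold>\<not> x) ?q) (seg s' t' l)" for l
  have z_eq: "z l = Complex (a l - 1/2) (b l - 1/2)" for l by (simp add: z_def pos_def a_def b_def)
  have unit: "0 \<le> a l" "a l \<le> 1" "0 \<le> b l" "b l \<le> 1"
    and edge: "a l = 0 \<or> a l = 1 \<or> b l = 0 \<or> b l = 1"
    and w_eq: "w l = Complex (rot (a l) (b l) l - 1/2) (rot (b l) (1 - a l) l - 1/2)"
    and z_nz: "z l \<noteq> 0"
    if l: "l \<in> {0..1}" for l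
  proof -
    have state: "fp_state (seg s t l)" "fp_state (seg s' t' l)"
      using st st' l by (auto intro: fp_state_seg)
    then have uv: "unit_valued (seg s t l)" "unit_valued (seg s' t' l)" by (simp_all add: fp_state_def)
    show "0 \<le> a l" "a l \<le> 1" "0 \<le> b l" "b l \<le> 1"
      unfolding a_def b_def by (intro eval_range uv)+
    show "a l = 0 \<or> a l = 1 \<or> b l = 0 \<or> b l = 1"
      unfolding a_def b_def by (rule eval_Bd[OF state(1) bd])
    show "w l = Complex (rot (a l) (b l) l - 1/2) (rot (b l) (1 - a l) l - 1/2)"
      by (simp add: w_def pos_def eval_Rot[OF uv(2)] same q a_def b_def)
    show "z l \<noteq> 0" unfolding z_def using norm_pos_ge[OF state(1) bd] by auto
  qed
  have nonpos: "w l / z l \<notin> \<real>\<^sub>\<le>\<^sub>0" if l: "l \<in> {0..1}" for l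
  proof
    assume "w l / z l \<in> \<real>\<^sub>\<le>\<^sub>0"
    then obtain r where r: "r \<le> 0" "w l / z l = of_real r" by (auto elim: nonpos_Reals_cases)
    then have "w l = of_real r * z l" using z_nz[OF l] by (simp add: field_simps)
    then have "rot (a l) (b l) l - 1/2 = r * (a l - 1/2)" "rot (b l) (1 - a l) l - 1/2 = r * (b l - 1/2)"
      by (simp_all add: w_eq[OF l] z_eq complex_eq_iff)
    then show False using rot_not_opposite[OF unit[OF l] _ _ edge[OF l] r(1), of l] l by auto
  qed
  \<comment> \<open>The principal logarithm turns the lift of \<open>z\<close> into a lift of
    \<open>w\<close>. It goes from \<open>Ln 1\<close> to \<open>Ln \<i>\<close>, whence the
    additional \<open>pi / 2\<close>.\<close>
  define h where "h l = g l + Ln (w l / z l)" for l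
  have "continuous_on {0..1} z" "continuous_on {0..1} w"
    unfolding z_def w_def by (intro continuous_on_pos continuous_on_seg)+
  then have "continuous_on {0..1} h"
    unfolding h_def using g(1) nonpos z_nz by (intro continuous_intros) auto
  moreover have "exp (h l) = w l" if l: "l \<in> {0..1}" for l
  proof -
    have "w l / z l \<noteq> 0" using nonpos[OF l] by auto
    then show ?thesis
      using z_nz[OF l] g(2)[OF l] by (simp add: h_def exp_add z_def)
  qed
  ultimately have "Im (h 1) - Im (h 0) \<in> disps (Rot x y ?q) (Rot y (\<^bold>\<not> x) ?q)"
    unfolding w_def using st' by (intro dispsI)
  moreover have "Im (h 1) - Im (h 0) = d + pi / 2"
  proof -
    have 0: "(0::real) \<in> {0..1}" and 1: "(1::real) \<in> {0..1}" by simp_all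
    have "w 0 = z 0"
      using rot_zero_one(1)[OF unit[OF 0] edge[OF 0]]
        rot_zero_one(1)[of "b 0" "1 - a 0"] unit[OF 0] edge[OF 0] by (auto simp: w_eq[OF 0] z_eq)
    moreover have "w 1 = \<i> * z 1"
      using rot_zero_one(2)[OF unit[OF 1] edge[OF 1]]
        rot_zero_one(2)[of "b 1" "1 - a 1"] unit[OF 1] edge[OF 1]
      by (auto simp: w_eq[OF 1] z_eq complex_eq_iff)
    ultimately show ?thesis using z_nz[OF 0] z_nz[OF 1] by (simp add: h_def d)
  qed
  ultimately show ?thesis by simp
qed

abbreviation p0 :: event where "p0 \<equiv> Atom 0"
abbreviation p1 :: event where "p1 \<equiv> Atom (Suc 0)"

definition square_problem :: problem where
  "square_problem = ({p0, p1}, {(Bd (Pr p0) (Pr p1), \<^bold>\<top>)})"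

lemma square_is_problem: "is_problem square_problem"
  by (simp add: square_problem_def is_problem_def Bd_def)

lemma unifiers_square: "\<sigma> \<in> unifiers square_problem \<longleftrightarrow> \<turnstile>\<^sub>F\<^sub>P Bd (\<sigma> p0) (\<sigma> p1)"
proof -
  have "prob_subst {p0, p1} \<sigma>"
    using prob_subst_variables[of \<sigma>] unfolding prob_subst_def by (meson bot.extremum dual_order.trans insert_subset rangeI)
  then show ?thesis by (simp add: square_problem_def unifiers_def Bd_def fp_iff_Top)
qed

lemma finite_atoms: "finite (atoms \<phi>)"
  by (induction \<phi>) simp_all

text \<open>Inclusion is transitive, so the result for a single factor passes to the generated
  preorder.\<close>

lemma preorder_disps:
  assumes "(\<sigma>, \<tau>) \<in> unifier_preorder square_problem"
  shows "disps (\<sigma> p0) (\<sigma> p1) \<subseteq> disps (\<tau> p0) (\<tau> p1)"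
proof -
  have step: "disps (\<sigma> p0) (\<sigma> p1) \<subseteq> disps (\<tau> p0) (\<tau> p1)"
    if "\<tau> \<in> unifiers square_problem" "less_general {p0, p1} \<sigma> \<tau>" for \<sigma> \<tau>
  proof -
    from that(2) obtain \<delta> where \<delta>: "prob_subst (\<Union>\<phi>\<in>{p0, p1}. atoms (\<tau> \<phi>)) \<delta>"
      and eq: "\<And>t. atoms t \<subseteq> {p0, p1} \<Longrightarrow> \<turnstile>\<^sub>F\<^sub>P subst \<sigma> t \<^bold>\<leftrightarrow> subst \<delta> (subst \<tau> t)"
      unfolding less_general_def by blast
    show ?thesis
      using disps_factor[OF _ \<delta>] that(1) eq[of "Pr p0"] eq[of "Pr p1"] by (simp add: unifiers_square)
  qed
  have "(\<sigma>, \<tau>) \<in> {(\<sigma>, \<tau>). \<sigma> \<in> unifiers square_problem \<and> \<tau> \<in> unifiers square_problem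
      \<and> less_general {p0, p1} \<sigma> \<tau>}\<^sup>*"
    using assms by (simp add: unifier_preorder_def square_problem_def)
  then show ?thesis
    by (induction rule: rtrancl_induct) (use step in blast)+
qed

lemma square_strictly_more_general:
  assumes \<tau>: "\<tau> \<in> unifiers square_problem"
  obtains \<tau>' where "\<tau>' \<in> unifiers square_problem" "(\<tau>, \<tau>') \<in> unifier_preorder square_problem"
    "(\<tau>', \<tau>) \<notin> unifier_preorder square_problem"
proof -
  let ?x = "\<tau> p0" and ?y = "\<tau> p1"
  have bd: "\<turnstile>\<^sub>F\<^sub>P Bd ?x ?y" using \<tau> by (simp add: unifiers_square)
  have "finite (\<Union>\<phi>\<in>atoms ?x \<union> atoms ?y. atoms \<phi>)" by (simp add: finite_atoms)
  then obtain m where "m \<notin> (\<Union>\<phi>\<in>atoms ?x \<union> atoms ?y. atoms \<phi>)"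
    using ex_new_if_finite infinite_UNIV_nat by blast
  then have fresh: "m \<notin> atoms \<phi>" if "\<phi> \<in> atoms ?x \<union> atoms ?y" for \<phi> using that by blast
  let ?q = "Pr (Atom m)"
  define \<tau>' where "\<tau>' = Pr(p0 := Rot ?x ?y ?q, p1 := Rot ?y (\<^bold>\<not> ?x) ?q)"
  have \<tau>'_simps: "\<tau>' p0 = Rot ?x ?y ?q" "\<tau>' p1 = Rot ?y (\<^bold>\<not> ?x) ?q" by (simp_all add: \<tau>'_def)
  have \<tau>': "\<tau>' \<in> unifiers square_problem"
    using fp_Bd_Rot[OF bd] by (simp add: unifiers_square \<tau>'_simps)
  \<comment> \<open>Setting the amount of rotation to zero recovers \<open>\<tau>\<close>.\<close>
  define \<delta> where "\<delta> = Pr(Atom m := \<^bold>\<bottom>)"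
  define B where "B = insert (Atom m) (atoms ?x \<union> atoms ?y)"
  \<comment> \<open>On \<open>B\<close> the factor agrees up to FP equivalence with a substitution
    in events, and so inherits preservation of equivalences.\<close>
  have Bot: "\<turnstile>\<^sub>F\<^sub>P \<delta> \<phi> \<^bold>\<leftrightarrow> Pr (subst (Atom(m := \<^bold>\<bottom>)) \<phi>)" if "\<phi> \<in> B" for \<phi>
  proof (cases "\<phi> = Atom m")
    case True
    then show ?thesis using fp_Bot by (simp add: \<delta>_def fp_iff fp.cong_sym)
  next
    case False
    then have "subst (Atom(m := \<^bold>\<bottom>)) \<phi> = \<phi>" using that fresh by (intro subst_id) (auto simp: B_def)
    then show ?thesis using False by (simp add: \<delta>_def fp_iff_refl)
  qed
  have "prob_subst B \<delta>"
    unfolding prob_subst_def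
  proof (intro allI impI)
    fix \<Phi> \<Psi> :: mfm
    assume B: "atoms \<Phi> \<subseteq> B" "atoms \<Psi> \<subseteq> B" and eq: "\<turnstile>\<^sub>F\<^sub>P \<Phi> \<^bold>\<leftrightarrow> \<Psi>"
    let ?e = "\<lambda>\<phi>. Pr (subst (Atom(m := \<^bold>\<bottom>)) \<phi>)"
    have "\<turnstile>\<^sub>F\<^sub>P subst ?e \<Phi> \<^bold>\<leftrightarrow> subst ?e \<Psi>" using fp_event_subst[OF eq] by simp
    moreover have "\<turnstile>\<^sub>F\<^sub>P subst \<delta> \<Phi> \<^bold>\<leftrightarrow> subst ?e \<Phi>" "\<turnstile>\<^sub>F\<^sub>P subst \<delta> \<Psi> \<^bold>\<leftrightarrow> subst ?e \<Psi>"
      using B Bot by (auto intro!: fp_subst_cong)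
    ultimately show "\<turnstile>\<^sub>F\<^sub>P subst \<delta> \<Phi> \<^bold>\<leftrightarrow> subst \<delta> \<Psi>"
      unfolding fp_iff by (meson fp.cong_sym fp.cong_trans)
  qed
  moreover have "(\<Union>\<phi>\<in>{p0, p1}. atoms (\<tau>' \<phi>)) = B"
    by (auto simp: \<tau>'_simps Rot_def B_def)
  moreover have "\<turnstile>\<^sub>F\<^sub>P subst \<tau> t \<^bold>\<leftrightarrow> subst \<delta> (subst \<tau>' t)" if "atoms t \<subseteq> {p0, p1}" for t
    unfolding subst_subst
  proof (rule fp_subst_cong)
    fix a assume "a \<in> atoms t"
    have \<delta>_m: "\<delta> (Atom m) = \<^bold>\<bottom>" by (simp add: \<delta>_def)
    have fixed: "subst \<delta> ?x = ?x" "subst \<delta> ?y = ?y"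
      using fresh[of "Atom m"] by (auto intro!: subst_id simp: \<delta>_def)
    have "cls (subst \<delta> (\<tau>' a)) = cls (\<tau> a)" if "a = p0 \<or> a = p1"
      using that by (auto simp: \<tau>'_simps subst_Rot cls_Rot fixed \<delta>_m mv_rot_simps)
    then show "\<turnstile>\<^sub>F\<^sub>P \<tau> a \<^bold>\<leftrightarrow> subst \<delta> (\<tau>' a)"
      using \<open>a \<in> atoms t\<close> that by (auto simp: fp_iff)
  qed
  ultimately have "less_general {p0, p1} \<tau> \<tau>'" unfolding less_general_def by auto
  then have up: "(\<tau>, \<tau>') \<in> unifier_preorder square_problem"
    using \<tau> \<tau>' by (auto simp: unifier_preorder_def square_problem_def)
  have "(\<tau>', \<tau>) \<notin> unifier_preorder square_problem"
  proof
    assume "(\<tau>', \<tau>) \<in> unifier_preorder square_problem"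
    \<comment> \<open>Closure under adding a quarter turn would make the displacements of
      \<open>\<tau>\<close> unbounded.\<close>
    then have step: "d + pi / 2 \<in> disps ?x ?y" if "d \<in> disps ?x ?y" for d
      using preorder_disps[of \<tau>' \<tau>] disps_Rot[OF bd fresh that] unfolding \<tau>'_simps by blast
    obtain d where d: "d \<in> disps ?x ?y" using disps_nonempty[OF bd] by blast
    have iter: "d + n * (pi / 2) \<in> disps ?x ?y" for n :: nat
    proof (induction n)
      case (Suc n)
      then have "d + n * (pi / 2) + pi / 2 \<in> disps ?x ?y" by (rule step)
      moreover have "d + real (Suc n) * (pi / 2) = d + n * (pi / 2) + pi / 2"
        by (simp add: field_simps)
      ultimately show ?case by (simp only:)
    qed (simp add: d)
    obtain C where C: "\<And>d. d \<in> disps ?x ?y \<Longrightarrow> d \<le> C" using disps_bounded[OF bd] by blast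
    obtain n :: nat where "C - d < n * (pi / 2)"
      using ex_less_of_nat_mult[of "pi / 2" "C - d"] by auto
    then show False using C[OF iter[of n]] by simp
  qed
  then show thesis using that \<tau>' up by blast
qed

lemma square_nullary: "problem_type square_problem = Nullary"
proof -
  let ?I = square_problem
  have beyond: "\<exists>Y\<in>unifier_poset ?I. unifier_class_le ?I X Y \<and> \<not> unifier_class_le ?I Y X"
    if "X \<in> unifier_poset ?I" for X
  proof -
    from that obtain \<tau> where \<tau>: "\<tau> \<in> unifiers ?I" "X = unifier_equiv ?I `` {\<tau>}"
      unfolding unifier_poset_def by (auto elim: quotientE)
    then obtain \<tau>' where "\<tau>' \<in> unifiers ?I" "(\<tau>, \<tau>') \<in> unifier_preorder ?I" "(\<tau>', \<tau>) \<notin> unifier_preorder ?I"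
      using square_strictly_more_general by blast
    then show ?thesis
      using \<tau> by (intro bexI[of _ "unifier_equiv ?I `` {\<tau>'}"])
        (auto simp: unifier_class_le_classes unifier_poset_def intro: quotientI)
  qed
  have "maximal_elements (unifier_poset ?I) (unifier_class_le ?I) = {}"
    unfolding maximal_elements_def using beyond by blast
  moreover have "\<not> (\<exists>m\<in>unifier_poset ?I. \<forall>x\<in>unifier_poset ?I. unifier_class_le ?I x m)"
    using beyond by blast
  ultimately show ?thesis by (simp add: problem_type_def poset_type_def)
qed

theorem theorem6p17: "FP_unification_type = Nullary"
proof -
  \<comment> \<open>A corner of the square is a constant unifier, so the problem is among those
    classified.\<close>
  have "(\<lambda>_. \<^bold>\<bottom>) \<in> unifiers square_problem"
    by (simp add: unifiers_square Bd_def fp_of_luk luk_thm_iff_cls)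
  then have "Nullary \<in> {problem_type I | I. is_problem I \<and> unifiers I \<noteq> {}}"
    using square_is_problem square_nullary by (intro CollectI exI[of _ square_problem]) auto
  moreover have "finite (UNIV :: unif_type set)"
  proof (rule finite_subset)
    show "UNIV \<subseteq> {Unitary, Finitary, Infinitary, Nullary}"
      using unif_type.exhaust by blast
  qed simp
  moreover have "T \<le> Nullary" for T by (cases T) (simp_all add: less_eq_unif_type_def)
  ultimately show ?thesis
    unfolding FP_unification_type_def by (intro Max_eqI) (auto intro: finite_subset)
qed

end
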